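(* There is an $\omega$-bounded Type I surface $S$ spanned by dominant subsets such that there is an unbounded continuous $f:S\to\mathbb{L}_{\ge 0}$ that is bounded on each locally dominant subset of $S$.
   Context: All spaces are Hausdorff and all functions are continuous unless otherwise specified. A space $X$ is Type I if $X=\bigcup_{\alpha<\omega_1}X_\alpha$ with each $X_\alpha$ open, $\overline{X_\alpha}$ Lindelöf, and $\overline{X_\alpha}\subset X_\beta$ whenever $\alpha<\beta$; Type I spaces are always assumed non-Lindelöf. A subset of a Type I space is bounded if it is contained in some $X_\alpha$, otherwise unbounded; a function into a Type I space is (un)bounded if its range is. Club means closed and unbounded. $\mathbb{L}_{\ge 0}$ is the closed long ray $\omega_1\times[0,1)$ with the lexicographic order topology (with $X_\alpha=[0,\alpha)$). A club $D\subset X$ is locally dominant if there is an open set $U\supset D$ such that for all continuous $f:X\to\mathbb{L}_{\ge 0}$, all club $C\subset U$ and all club $D'\subset D$ (clubs of $X$), $f|_{D'}$ bounded implies $f|_C$ bounded. An open subset of a Type I space is large if it contains a club set; a Type I space is spanned by dominant subsets if any large open subset contains a locally dominant subset (of the whole space). A space is $\omega$-bounded if the closure of every countable subset is compact. A surface is a 2-dimensional manifold, with or without boundary (connected, Hausdorff). *)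

theory Defs
  imports "HOL-Analysis.Analysis" "HOL-Library.Countable_Set_Type"
begin

text \<open>
  The type of countable ordinals, realised as the field of the cardinal successor of
  the cardinal of the natural numbers. The class instance together with the lemmas
  \<open>countable_lessThan_omega1\<close> and \<open>uncountable_UNIV_omega1\<close> determines it up to order
  isomorphism.
\<close>

typedef omega1 = "Field (cardSuc natLeq)"
  using Field_cardSuc_not_empty[OF natLeq_Card_order] by blast

instantiation omega1 :: wellorder
begin

definition less_eq_omega1 :: "omega1 \<Rightarrow> omega1 \<Rightarrow> bool"
  where "(x::omega1) \<le> y \<longleftrightarrow> (Rep_omega1 x, Rep_omega1 y) \<in> cardSuc natLeq"

definition less_omega1 :: "omega1 \<Rightarrow> omega1 \<Rightarrow> bool"
  where "(x::omega1) < y \<longleftrightarrow> x \<le> y \<and> x \<noteq> y"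

instance
proof
  have wo: "Well_order (cardSuc natLeq)"
    using cardSuc_Card_order[OF natLeq_Card_order] by (simp add: card_order_on_def)
  then have lin: "Linear_order (cardSuc natLeq)" and wfr: "wf (cardSuc natLeq - Id)"
    by (auto simp: well_order_on_def)
  then have tot: "Total (cardSuc natLeq)" and tr: "trans (cardSuc natLeq)"
    and anti: "antisym (cardSuc natLeq)" and re: "Refl (cardSuc natLeq)"
    by (auto simp: order_on_defs)
  fix x y z :: omega1
  show refl_x: "x \<le> x"
    using re Rep_omega1[of x] by (auto simp: less_eq_omega1_def refl_on_def)
  show trans_xyz: "x \<le> y \<Longrightarrow> y \<le> z \<Longrightarrow> x \<le> z"
    using tr unfolding less_eq_omega1_def by (rule transD)
  show anti_xy: "x \<le> y \<Longrightarrow> y \<le> x \<Longrightarrow> x = y"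
    using anti unfolding less_eq_omega1_def by (metis Rep_omega1_inject antisymD)
  show "(x < y) = (x \<le> y \<and> \<not> y \<le> x)"
    using anti re Rep_omega1[of x] unfolding less_omega1_def less_eq_omega1_def
    by (metis Rep_omega1_inject antisymD refl_onD)
  show "x \<le> y \<or> y \<le> x"
    using tot re Rep_omega1[of x] Rep_omega1[of y] unfolding less_eq_omega1_def
    by (metis refl_onD total_on_def)
  fix P :: "omega1 \<Rightarrow> bool" and a :: omega1
  assume step: "\<And>x. (\<And>y. y < x \<Longrightarrow> P y) \<Longrightarrow> P x"
  have "wf (inv_image (cardSuc natLeq - Id) Rep_omega1)"
    using wfr by (rule wf_inv_image)
  then show "P a"
  proof (induction a rule: wf_induct_rule)
    case (less x)
    show ?case
    proof (rule step)
      fix y assume "y < x"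
      then show "P y"
        using less by (simp add: less_omega1_def less_eq_omega1_def Rep_omega1_inject)
    qed
  qed
qed

end

lemma countable_lessThan_omega1:
  includes cardinal_syntax
  shows "countable {..<a :: omega1}"
proof -
  have sub: "Rep_omega1 ` {..<a} \<subseteq> underS (cardSuc natLeq) (Rep_omega1 a)"
    by (auto simp: underS_def less_omega1_def less_eq_omega1_def Rep_omega1_inject)
  have "|underS (cardSuc natLeq) (Rep_omega1 a)| <o cardSuc natLeq"
    using card_of_underS[OF cardSuc_Card_order[OF natLeq_Card_order] Rep_omega1] .
  then have "|underS (cardSuc natLeq) (Rep_omega1 a)| \<le>o natLeq"
    using cardSuc_ordLess_ordLeq natLeq_Card_order card_of_Card_order
      cardSuc_ordLeq_ordLess by blast
  then have "countable (underS (cardSuc natLeq) (Rep_omega1 a))"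
    by (simp add: countable_card_le_natLeq)
  then have "countable (Rep_omega1 ` {..<a})"
    using sub countable_subset by blast
  then show ?thesis
    by (rule countable_image_inj_on) (simp add: inj_on_def Rep_omega1_inject)
qed

lemma uncountable_UNIV_omega1:
  includes cardinal_syntax
  shows "uncountable (UNIV :: omega1 set)"
proof
  assume "countable (UNIV :: omega1 set)"
  then have "countable (range Rep_omega1)" by simp
  then have "countable (Field (cardSuc natLeq))"
    using type_definition.Rep_range[OF type_definition_omega1] by simp
  then have "|Field (cardSuc natLeq)| \<le>o natLeq"
    by (simp add: countable_card_le_natLeq)
  moreover have "|Field (cardSuc natLeq)| =o cardSuc natLeq"
    by (rule card_of_Field_ordIso[OF cardSuc_Card_order[OF natLeq_Card_order]])
  ultimately have "cardSuc natLeq \<le>o natLeq"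
    using ordIso_symmetric ordIso_ordLeq_trans by blast
  moreover have "natLeq <o cardSuc natLeq"
    by (rule cardSuc_greater[OF natLeq_Card_order])
  ultimately show False
    using not_ordLess_ordLeq by blast
qed

typedef longray = "{p :: omega1 \<times> real. 0 \<le> snd p \<and> snd p < 1}"
  by (rule exI[of _ "(undefined, 0)"]) simp

instantiation longray :: linorder
begin

definition less_longray :: "longray \<Rightarrow> longray \<Rightarrow> bool"
  where "(x::longray) < y \<longleftrightarrow> fst (Rep_longray x) < fst (Rep_longray y) \<or>
     fst (Rep_longray x) = fst (Rep_longray y) \<and> snd (Rep_longray x) < snd (Rep_longray y)"

definition less_eq_longray :: "longray \<Rightarrow> longray \<Rightarrow> bool"
  where "(x::longray) \<le> y \<longleftrightarrow> x < y \<or> x = y"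

instance
proof
  fix x y z :: longray
  show "(x < y) = (x \<le> y \<and> \<not> y \<le> x)"
    by (auto simp: less_eq_longray_def less_longray_def)
  show "x \<le> x"
    by (simp add: less_eq_longray_def)
  show "x \<le> y \<Longrightarrow> y \<le> z \<Longrightarrow> x \<le> z"
    by (auto simp: less_eq_longray_def less_longray_def)
  show "x \<le> y \<Longrightarrow> y \<le> x \<Longrightarrow> x = y"
    by (auto simp: less_eq_longray_def less_longray_def)
  show "x \<le> y \<or> y \<le> x"
    by (auto simp: less_eq_longray_def less_longray_def Rep_longray_inject[symmetric]
        prod_eq_iff)
qed

end

instantiation longray :: linorder_topology
begin

definition open_longray :: "longray set \<Rightarrow> bool"
  where "open_longray = generate_topology (range (\<lambda>a. {..<a}) \<union> range (\<lambda>a. {a<..}))"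

instance
  by standard (rule open_longray_def)

end

definition longray_initial :: "omega1 \<Rightarrow> longray set"
  where "longray_initial \<alpha> = {..<Abs_longray (\<alpha>, 0)}"

text \<open>
  A Type I space is given together with a witnessing family \<open>F\<close>. The bounded sets do
  not depend on the choice of \<open>F\<close>: each \<open>X closure_of F \<alpha>\<close> is Lindelof, hence contained
  in a single member of any other such family.
\<close>

definition type_I :: "'a topology \<Rightarrow> (omega1 \<Rightarrow> 'a set) \<Rightarrow> bool"
  where "type_I X F \<longleftrightarrow>
     Hausdorff_space X \<and> \<not> Lindelof_space X \<and>
     topspace X = (\<Union>\<alpha>. F \<alpha>) \<and>
     (\<forall>\<alpha>. openin X (F \<alpha>)) \<and>
     (\<forall>\<alpha>. Lindelof_space (subtopology X (X closure_of F \<alpha>))) \<and>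
     (\<forall>\<alpha> \<beta>. \<alpha> < \<beta> \<longrightarrow> X closure_of F \<alpha> \<subseteq> F \<beta>)"

definition type_I_bounded :: "(omega1 \<Rightarrow> 'a set) \<Rightarrow> 'a set \<Rightarrow> bool"
  where "type_I_bounded F A \<longleftrightarrow> (\<exists>\<alpha>. A \<subseteq> F \<alpha>)"

definition club :: "'a topology \<Rightarrow> (omega1 \<Rightarrow> 'a set) \<Rightarrow> 'a set \<Rightarrow> bool"
  where "club X F C \<longleftrightarrow> closedin X C \<and> \<not> type_I_bounded F C"

definition bounded_on :: "('a \<Rightarrow> longray) \<Rightarrow> 'a set \<Rightarrow> bool"
  where "bounded_on f A \<longleftrightarrow> type_I_bounded longray_initial (f ` A)"

definition locally_dominant :: "'a topology \<Rightarrow> (omega1 \<Rightarrow> 'a set) \<Rightarrow> 'a set \<Rightarrow> bool"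
  where "locally_dominant X F D \<longleftrightarrow>
     club X F D \<and>
     (\<exists>U. openin X U \<and> D \<subseteq> U \<and>
        (\<forall>f C D'. continuous_map X euclidean f \<and> club X F C \<and> C \<subseteq> U \<and>
           club X F D' \<and> D' \<subseteq> D \<and> bounded_on f D' \<longrightarrow> bounded_on f C))"

definition large :: "'a topology \<Rightarrow> (omega1 \<Rightarrow> 'a set) \<Rightarrow> 'a set \<Rightarrow> bool"
  where "large X F U \<longleftrightarrow> openin X U \<and> (\<exists>C. club X F C \<and> C \<subseteq> U)"

definition spanned_by_dominant :: "'a topology \<Rightarrow> (omega1 \<Rightarrow> 'a set) \<Rightarrow> bool"
  where "spanned_by_dominant X F \<longleftrightarrow>
     (\<forall>U. large X F U \<longrightarrow> (\<exists>D. locally_dominant X F D \<and> D \<subseteq> U))"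

definition omega_bounded_space :: "'a topology \<Rightarrow> bool"
  where "omega_bounded_space X \<longleftrightarrow>
     (\<forall>A. A \<subseteq> topspace X \<and> countable A \<longrightarrow> compactin X (X closure_of A))"

text \<open>
  Open subsets of the closed half plane serve as charts for both interior and boundary
  points. No countability or metrizability condition is imposed.
\<close>

definition half_plane :: "(real \<times> real) topology"
  where "half_plane = subtopology euclidean {p. 0 \<le> snd p}"

definition surface :: "'a topology \<Rightarrow> bool"
  where "surface X \<longleftrightarrow>
     Hausdorff_space X \<and> connected_space X \<and>
     (\<forall>x\<in>topspace X. \<exists>U V. openin X U \<and> x \<in> U \<and> openin half_plane V \<and>
        subtopology X U homeomorphic_space subtopology half_plane V)"

end

theory Submission
  imports Defs
begin

text \<open>
  Write \<open>L\<close> for the closed long ray. In the octant \<open>{(x, v) \<in> L \<times> L. v \<le> x}\<close> the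
  function \<open>v\<close> is bounded on every horizontal line but not on the diagonal. The diagonal is
  locally dominant there, because a function that is bounded on it is bounded on all horizontal
  lines. The surface is obtained from the octant by destroying this dominance: for every
  countable ordinal \<open>g\<close> the horizontal line \<open>v = g\<close> is replaced by a whole octant
  \<open>{(x, z). g \<le> z \<le> x}\<close>, whose edge \<open>z = x\<close> is glued to the part \<open>v < g\<close> and whose edge
  \<open>z = g\<close> is glued to the part \<open>v > g\<close>. The depth \<open>z\<close> in this octant extends continuously
  to the whole surface, by \<open>x\<close> below the octant and by \<open>g\<close> above it. It
  is unbounded on one edge of its octant but bounded on the diagonal \<open>v = x\<close>, and every
  neighbourhood of the diagonal contains such edges.

  The points are recorded by all these coordinates at once, which makes the surface a closed
  subset of a product of long rays (\<open>layers\<close>). Tychonoff's theorem then gives compactness of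
  \<open>{x \<le> a}\<close>, hence the Type I structure and \<open>\<omega>\<close>-boundedness. That it is a surface
  with boundary follows from explicit charts: each fibre of \<open>x\<close> is a linearly ordered arc, and
  a weighted sum of the countably many coordinates that vary on \<open>{x < a}\<close> measures
  the distance of a point from the bottom and from the top of its fibre. The two distances map
  \<open>{x < a}\<close> homeomorphically onto a triangle (\<open>below_homeomorphism\<close>).

  The unbounded function is \<open>v\<close>. Suppose that it is unbounded on a locally dominant set
  \<open>D\<close>, with \<open>U\<close> as in the definition. Two closed sets on which \<open>v\<close> is unbounded meet on
  the diagonal \<open>v = x\<close> (\<open>meet_on_edge\<close>), so \<open>v\<close> is bounded on the complement of \<open>U\<close>, and
  \<open>U\<close> contains the edge \<open>v = g, z = x\<close> of some octant. The depth \<open>z\<close> of that octant is unbounded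
  on this edge but bounded on the diagonal points of \<open>D\<close>, which form a club: a contradiction
  (\<open>lev_bounded_if_dominant\<close>).

  Dominant sets are nevertheless plentiful. A tail of a line on which a coordinate is constant,
  inside a strip homeomorphic to the product of a tail of \<open>L\<close> and a compact interval, is
  locally dominant (\<open>line_locally_dominant\<close>), since boundedness of a function on one line of
  a strip spreads to the whole strip by connectedness of the interval (\<open>strip_bounded\<close>). Lines with
  \<open>v\<close> constant between two consecutive ordinals, and lines with \<open>z\<close> constant and larger than
  \<open>g\<close> in the octant of \<open>g\<close>, are of this kind. If the complement \<open>K\<close> of an open set met all
  these lines in unbounded sets, then \<open>K\<close> would meet every club
  (\<open>large_contains_dominant\<close>).

  All arguments with clubs use one device: two sequences that leapfrog each other converge
  to the same limit ordinal in the coordinate \<open>x\<close>, and compactness provides cluster points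
  there (\<open>leapfrog\<close>). Since a point is determined by three coordinates, the
  surface finally has a copy whose points are real numbers.
\<close>

section \<open>The countable ordinals and the long ray\<close>

lemma countable_atMost_omega1: "countable {..a :: omega1}"
proof -
  have "{..a} = insert a {..<a}" by auto
  then show ?thesis using countable_lessThan_omega1[of a] by simp
qed

lemma countable_omega1_bounded:
  fixes A :: "omega1 set"
  assumes "countable A"
  shows "\<exists>b. \<forall>a\<in>A. a < b"
proof (rule ccontr)
  assume "\<not> ?thesis"
  then have "UNIV = (\<Union>a\<in>A. {..a})" by (force simp: not_less)
  moreover have "countable (\<Union>a\<in>A. {..a})"
    using assms countable_atMost_omega1 by blast
  ultimately show False using uncountable_UNIV_omega1 by simp
qed

lemma omega1_gt_ex: "\<exists>b :: omega1. a < b"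
  using countable_omega1_bounded[of "{a}"] by auto

definition block :: "longray \<Rightarrow> omega1"
  where "block x = fst (Rep_longray x)"

definition offset :: "longray \<Rightarrow> real"
  where "offset x = snd (Rep_longray x)"

definition vertex :: "omega1 \<Rightarrow> longray"
  where "vertex a = Abs_longray (a, 0)"

lemma offset_bounds: "0 \<le> offset x" "offset x < 1"
  using Rep_longray[of x] by (auto simp: offset_def)

lemma block_offset_Abs [simp]:
  assumes "0 \<le> r" "r < 1"
  shows "block (Abs_longray (a, r)) = a" "offset (Abs_longray (a, r)) = r"
  using assms by (auto simp: block_def offset_def Abs_longray_inverse)

lemma block_vertex [simp]: "block (vertex a) = a"
  and offset_vertex [simp]: "offset (vertex a) = 0"
  by (simp_all add: vertex_def)

lemma less_longray_iff:
  "x < y \<longleftrightarrow> block x < block y \<or> block x = block y \<and> offset x < offset y"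
  by (simp add: less_longray_def block_def offset_def)

lemma longray_eq_iff: "x = y \<longleftrightarrow> block x = block y \<and> offset x = offset y"
  by (metis Rep_longray_inject block_def offset_def prod_eq_iff)

lemma le_longray_iff:
  "x \<le> y \<longleftrightarrow> block x < block y \<or> block x = block y \<and> offset x \<le> offset y"
  by (auto simp: less_eq_longray_def less_longray_iff longray_eq_iff)

lemma block_mono: "x \<le> y \<Longrightarrow> block x \<le> block y"
  by (auto simp: le_longray_iff)

lemma less_vertex_iff: "x < vertex a \<longleftrightarrow> block x < a"
  using offset_bounds[of x] by (auto simp: less_longray_iff)

lemma vertex_le_iff: "vertex a \<le> x \<longleftrightarrow> a \<le> block x"
  by (metis less_vertex_iff not_less)

lemma vertex_less_vertex [simp]: "vertex a < vertex b \<longleftrightarrow> a < b"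
  by (simp add: less_vertex_iff)

lemma vertex_le_vertex [simp]: "vertex a \<le> vertex b \<longleftrightarrow> a \<le> b"
  by (simp add: vertex_le_iff)

lemma vertex_inject [simp]: "vertex a = vertex b \<longleftrightarrow> a = b"
  by (metis block_vertex)

lemma longray_initial_eq: "longray_initial a = {..<vertex a}"
  by (simp add: longray_initial_def vertex_def)

lemma longray_bounded_iff:
  "bounded_on g A \<longleftrightarrow> (\<exists>a. \<forall>p\<in>A. g p < vertex a)"
  by (auto simp: bounded_on_def type_I_bounded_def longray_initial_eq)

lemma longray_less_vertex: "\<exists>a. x < vertex a"
  by (simp add: less_vertex_iff omega1_gt_ex)

definition origin :: longray
  where "origin = vertex (LEAST a. True)"

lemma origin_le [simp]: "origin \<le> x"
  unfolding origin_def vertex_le_iff by (rule Least_le) simp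

text \<open>
  Every \<open>\<omega>\<close>-sequence is bounded, so its least strict upper bound exists; for an increasing
  sequence this is a limit ordinal that is also the limit in the long ray.
\<close>

lemma omega1_sequence_limit:
  fixes a :: "nat \<Rightarrow> omega1"
  assumes "strict_mono a"
  obtains l where "\<And>n. a n < l" "(\<lambda>n. vertex (a n)) \<longlonglongrightarrow> vertex l"
proof -
  define l where "l = (LEAST b. \<forall>n. a n < b)"
  have ub: "\<forall>n. a n < l"
    unfolding l_def
    by (rule LeastI_ex) (use countable_omega1_bounded[of "range a"] in auto)
  have "(\<lambda>n. vertex (a n)) \<longlonglongrightarrow> vertex l"
  proof (rule order_tendstoI)
    fix y assume "y < vertex l"
    then have "block y < l" by (simp add: less_vertex_iff)
    then have "\<not> (\<forall>n. a n < block y)"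
      unfolding l_def using not_less_Least by blast
    then obtain m where "block y \<le> a m" by (auto simp: not_less)
    then have "block y < a (Suc m)"
      using strict_monoD[OF assms, of m "Suc m"] by auto
    moreover have "a (Suc m) \<le> a n" if "n \<ge> Suc m" for n
      using assms that by (simp add: strict_mono_less_eq)
    ultimately have "\<forall>n\<ge>Suc m. y < vertex (a n)"
      by (meson less_le_trans less_vertex_iff)
    then show "\<forall>\<^sub>F n in sequentially. y < vertex (a n)"
      using eventually_sequentially by blast
  next
    fix y assume "vertex l < y"
    then have "\<And>n. vertex (a n) < y"
      using ub by (meson less_trans vertex_less_vertex)
    then show "\<forall>\<^sub>F n in sequentially. vertex (a n) < y"
      by simp
  qed
  then show ?thesis using that ub by blast
qed

text \<open>
  Among the upper bounds first minimise the block, which is possible by well-ordering, and then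
  take the infimum of the offsets of the upper bounds in that block.
\<close>

lemma longray_least_upper_bound:
  fixes X :: "longray set"
  assumes "bdd_above X"
  shows "\<exists>s. (\<forall>x\<in>X. x \<le> s) \<and> (\<forall>z. (\<forall>x\<in>X. x \<le> z) \<longrightarrow> s \<le> z)"
proof -
  define U where "U = {z. \<forall>x\<in>X. x \<le> z}"
  obtain z0 where z0: "z0 \<in> U" using assms by (auto simp: U_def bdd_above_def)
  define g where "g = (LEAST b. b \<in> block ` U)"
  have "g \<in> block ` U" unfolding g_def by (rule LeastI_ex) (use z0 in blast)
  then obtain z1 where z1: "z1 \<in> U" "block z1 = g" by auto
  have g_le: "g \<le> block z" if "z \<in> U" for z
    unfolding g_def by (rule Least_le) (use that in blast)
  define R where "R = offset ` {z \<in> U. block z = g}"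
  have R: "R \<noteq> {}" "bdd_below R"
    using z1 offset_bounds by (auto simp: R_def intro!: bdd_belowI[of _ 0])
  define r where "r = Inf R"
  have r0: "0 \<le> r" unfolding r_def by (rule cInf_greatest) (use R offset_bounds in \<open>auto simp: R_def\<close>)
  have "r \<le> offset z1" unfolding r_def by (rule cInf_lower) (use R z1 in \<open>auto simp: R_def\<close>)
  then have r1: "r < 1" using offset_bounds(2)[of z1] by simp
  define s where "s = Abs_longray (g, r)"
  have bs: "block s = g" "offset s = r" using r0 r1 by (auto simp: s_def)
  have "x \<le> s" if "x \<in> X" for x
  proof -
    have xz: "x \<le> z" if "z \<in> U" for z using \<open>x \<in> X\<close> that by (auto simp: U_def)
    have "block x \<le> g" using xz[OF z1(1)] block_mono z1(2) by blast
    moreover have "offset x \<le> r" if "block x = g"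
      unfolding r_def
    proof (rule cInf_greatest[OF R(1)])
      fix t assume "t \<in> R"
      then obtain z where "z \<in> U" "block z = g" "t = offset z" by (auto simp: R_def)
      then show "offset x \<le> t" using xz[of z] that by (auto simp: le_longray_iff)
    qed
    ultimately show ?thesis by (auto simp: le_longray_iff bs)
  qed
  moreover have "s \<le> z" if "\<forall>x\<in>X. x \<le> z" for z
  proof -
    have z: "z \<in> U" using that by (simp add: U_def)
    have "r \<le> offset z" if "block z = g"
      unfolding r_def by (rule cInf_lower) (use z that R in \<open>auto simp: R_def\<close>)
    then show ?thesis using g_le[OF z] by (auto simp: le_longray_iff bs)
  qed
  ultimately show ?thesis by blast
qed

text \<open>
  The long ray is a linear continuum, which provides connectedness of its intervals and the
  intermediate value theorem.
\<close>

instantiation longray :: linear_continuum_topology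
begin

definition sup_longray :: "longray \<Rightarrow> longray \<Rightarrow> longray"
  where "sup_longray = max"

definition inf_longray :: "longray \<Rightarrow> longray \<Rightarrow> longray"
  where "inf_longray = min"

definition Sup_longray :: "longray set \<Rightarrow> longray"
  where "Sup_longray X = (LEAST s. \<forall>x\<in>X. x \<le> s)"

text \<open>
  The infimum is the supremum of the lower bounds, so that its properties reduce to those of
  suprema.
\<close>

definition Inf_longray :: "longray set \<Rightarrow> longray"
  where "Inf_longray X = Sup {z. \<forall>x\<in>X. z \<le> x}"

instance
proof
  fix x y z :: longray and X :: "longray set"
  show "inf x y \<le> x" "inf x y \<le> y" "x \<le> y \<Longrightarrow> x \<le> z \<Longrightarrow> x \<le> inf y z"
    "x \<le> sup x y" "y \<le> sup x y" "y \<le> x \<Longrightarrow> z \<le> x \<Longrightarrow> sup y z \<le> x"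
    by (auto simp: inf_longray_def sup_longray_def)
  have Sup: "(\<forall>x\<in>X. x \<le> Sup X) \<and> (\<forall>z. (\<forall>x\<in>X. x \<le> z) \<longrightarrow> Sup X \<le> z)"
    if X: "bdd_above X" for X :: "longray set"
  proof -
    obtain s where s: "\<forall>x\<in>X. x \<le> s" "\<forall>z. (\<forall>x\<in>X. x \<le> z) \<longrightarrow> s \<le> z"
      using longray_least_upper_bound[OF X] by blast
    have "Sup X = s"
      unfolding Sup_longray_def by (rule Least_equality) (use s in auto)
    then show ?thesis using s by blast
  qed
  show "x \<in> X \<Longrightarrow> bdd_above X \<Longrightarrow> x \<le> Sup X" using Sup by blast
  show "X \<noteq> {} \<Longrightarrow> (\<And>x. x \<in> X \<Longrightarrow> x \<le> z) \<Longrightarrow> Sup X \<le> z"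
    using Sup[of X] by (meson bdd_aboveI)
  show "Inf X \<le> x" if "x \<in> X" "bdd_below X"
  proof -
    have "bdd_above {z. \<forall>x\<in>X. z \<le> x}" using that by (auto simp: bdd_above_def)
    then show ?thesis unfolding Inf_longray_def using Sup that by blast
  qed
  show "z \<le> Inf X" if "X \<noteq> {}" "\<And>x. x \<in> X \<Longrightarrow> z \<le> x"
  proof -
    have "bdd_above {z. \<forall>x\<in>X. z \<le> x}" using that by (auto simp: bdd_above_def)
    then show ?thesis unfolding Inf_longray_def using Sup that by blast
  qed
  show "\<exists>z. x < z \<and> z < y" if "x < y"
  proof (cases "block x < block y")
    case True
    have "x < Abs_longray (block x, (offset x + 1) / 2)"
      "Abs_longray (block x, (offset x + 1) / 2) < y"
      using offset_bounds[of x] True by (auto simp: less_longray_iff)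
    then show ?thesis by blast
  next
    case False
    then have b: "block x = block y" "offset x < offset y" using that by (auto simp: less_longray_iff)
    have "x < Abs_longray (block x, (offset x + offset y) / 2)"
      "Abs_longray (block x, (offset x + offset y) / 2) < y"
      using offset_bounds[of x] offset_bounds[of y] b by (auto simp: less_longray_iff)
    then show ?thesis by blast
  qed
  show "\<exists>a b :: longray. a \<noteq> b"
    by (metis longray_less_vertex less_irrefl)
qed

end

text \<open>
  The supremum of the points up to which finitely many members of the cover suffice is the right
  end point: otherwise the member that contains it also covers points to its right.
\<close>

lemma compact_Icc_linear_continuum:
  fixes a b :: "'a :: linear_continuum_topology"
  shows "compact {a..b}"
proof (cases "a \<le> b")
  case True
  show ?thesis
  proof (rule compactI)
    fix C assume op: "\<forall>t\<in>C. open t" and cov: "{a..b} \<subseteq> \<Union>C"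
    define A where "A = {x \<in> {a..b}. \<exists>D. D \<subseteq> C \<and> finite D \<and> {a..x} \<subseteq> \<Union>D}"
    obtain O0 where "O0 \<in> C" "a \<in> O0" using cov True by fastforce
    then have aA: "a \<in> A" using True by (auto simp: A_def intro!: exI[of _ "{O0}"])
    have bdd: "bdd_above A" by (auto simp: A_def bdd_above_def)
    define s where "s = Sup A"
    have sI: "s \<in> {a..b}"
    proof -
      have "a \<le> s" unfolding s_def using aA bdd by (rule cSup_upper)
      moreover have "s \<le> b"
        unfolding s_def by (rule cSup_least) (use aA in blast, simp add: A_def)
      ultimately show ?thesis by simp
    qed
    then obtain W where W: "W \<in> C" "s \<in> W" "open W" using cov op by blast
    obtain x where x: "x \<in> A" "x \<le> s" "{x..s} \<subseteq> W"
    proof (cases "a = s")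
      case True
      have "{a..s} \<subseteq> W" using W(2) True by simp
      then show ?thesis using that[of a] aA True by simp
    next
      case False
      then have "a < s" using sI by (simp add: less_le)
      then obtain l where l: "l < s" "{l<..s} \<subseteq> W" using open_left[OF W(3,2)] by blast
      then have "\<exists>x\<in>A. l < x"
        using less_cSup_iff[of A l] aA bdd unfolding s_def by blast
      then obtain x where "x \<in> A" "l < x" by blast
      moreover have "x \<le> s" unfolding s_def using \<open>x \<in> A\<close> bdd by (rule cSup_upper)
      moreover have "{x..s} \<subseteq> {l<..s}" using \<open>l < x\<close> by auto
      ultimately show ?thesis using that[of x] l(2) by blast
    qed
    obtain D where D: "D \<subseteq> C" "finite D" "{a..x} \<subseteq> \<Union>D" using x(1) by (auto simp: A_def)
    have covered_further: "y \<in> A" if y: "y \<in> {a..b}" "{s..y} \<subseteq> W" for y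
    proof -
      have "{a..y} \<subseteq> \<Union>(insert W D)"
      proof
        fix t assume t: "t \<in> {a..y}"
        show "t \<in> \<Union>(insert W D)"
        proof (cases "t \<le> x")
          case True then show ?thesis using D(3) t by auto
        next
          case False
          then have "t \<in> {x..s} \<or> t \<in> {s..y}" using t linear[of t s] by auto
          then have "t \<in> W" using x(3) y(2) by blast
          then show ?thesis by auto
        qed
      qed
      moreover have "insert W D \<subseteq> C" "finite (insert W D)" using D W by auto
      ultimately show ?thesis using y(1) unfolding A_def by blast
    qed
    have "s = b"
    proof (rule ccontr)
      assume "s \<noteq> b"
      then have "s < b" using sI by (simp add: less_le)
      then obtain r where r: "s < r" "{s..<r} \<subseteq> W" using open_right[OF W(3,2)] by blast
      then obtain m where m: "s < m" "m < min r b" using dense[of s "min r b"] \<open>s < b\<close> by auto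
      have "{s..m} \<subseteq> {s..<r}" using m by auto
      moreover have "m \<in> {a..b}" using m sI by auto
      ultimately have "m \<in> A" using covered_further r by blast
      then have "m \<le> s" unfolding s_def using bdd by (rule cSup_upper)
      then show False using m by simp
    qed
    then have "b \<in> A" using covered_further[of b] W sI by simp
    then show "\<exists>D\<subseteq>C. finite D \<and> {a..b} \<subseteq> \<Union>D" by (auto simp: A_def)
  qed
qed simp

section \<open>Real scales on initial segments of the long ray\<close>

text \<open>
  A monotone function without jumps is continuous. This avoids a case distinction between limit
  and successor positions in the long ray.
\<close>

lemma mono_darboux_continuous:
  fixes f :: "'a :: linorder_topology \<Rightarrow> real"
  assumes "mono f" and ivt: "\<And>x y c. f x < c \<Longrightarrow> c < f y \<Longrightarrow> \<exists>z. f z = c"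
  shows "continuous_on UNIV f"
proof -
  have "(f \<longlongrightarrow> f x) (nhds x)" for x
  proof (rule order_tendstoI)
    fix a assume a: "a < f x"
    show "\<forall>\<^sub>F y in nhds x. a < f y"
    proof (cases "\<exists>y. f y \<le> a")
      case True
      then obtain y where "f y \<le> a" by blast
      moreover obtain c where c: "a < c" "c < f x" using dense a by blast
      ultimately obtain z where z: "f z = c" using ivt[of y c x] by auto
      then have "z < x" using c \<open>mono f\<close> by (metis monoD not_less)
      then have "\<forall>\<^sub>F y in nhds x. z < y"
        using eventually_nhds_in_open[of "{z<..}"] by simp
      then show ?thesis
      proof eventually_elim
        case (elim y)
        then have "f z \<le> f y" using \<open>mono f\<close> by (simp add: monoD)
        then show ?case using z c by linarith
      qed
    qed (auto simp: not_le)
  next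
    fix a assume a: "f x < a"
    show "\<forall>\<^sub>F y in nhds x. f y < a"
    proof (cases "\<exists>y. a \<le> f y")
      case True
      then obtain y where "a \<le> f y" by blast
      moreover obtain c where c: "f x < c" "c < a" using dense a by blast
      ultimately obtain z where z: "f z = c" using ivt[of x c y] by auto
      then have "x < z" using c \<open>mono f\<close> by (metis monoD not_less)
      then have "\<forall>\<^sub>F y in nhds x. y < z"
        using eventually_nhds_in_open[of "{..<z}"] by simp
      then show ?thesis
      proof eventually_elim
        case (elim y)
        then have "f y \<le> f z" using \<open>mono f\<close> by (simp add: monoD)
        then show ?case using z c by linarith
      qed
    qed (auto simp: not_le)
  qed
  then have "(f \<longlongrightarrow> f x) (at x)" for x
    by (rule tendsto_mono[rotated]) (simp add: at_within_def)
  then show ?thesis by (simp add: continuous_on_def)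
qed

text \<open>
  The function that rises from 0 to 1 along the block of \<open>g\<close> and is constant elsewhere.
\<close>

definition ramp :: "omega1 \<Rightarrow> longray \<Rightarrow> real"
  where "ramp g x = (if block x < g then 0 else if block x = g then offset x else 1)"

lemma ramp_bounds: "0 \<le> ramp g x" "ramp g x \<le> 1"
  using offset_bounds[of x] by (auto simp: ramp_def)

lemma ramp_mono: "x \<le> y \<Longrightarrow> ramp g x \<le> ramp g y"
  using offset_bounds[of x] offset_bounds[of y] by (auto simp: ramp_def le_longray_iff)

lemma ramp_block_less: "x < y \<Longrightarrow> ramp (block x) x < ramp (block x) y"
  using offset_bounds[of x] by (auto simp: ramp_def less_longray_iff)

lemma continuous_on_ramp: "continuous_on A (ramp g)"
proof -
  have "continuous_on UNIV (ramp g)"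
  proof (rule mono_darboux_continuous)
    show "mono (ramp g)" by (simp add: monoI ramp_mono)
    fix x y c assume "ramp g x < c" "c < ramp g y"
    then have "0 < c" "c < 1" using ramp_bounds[of g x] ramp_bounds[of g y] by linarith+
    then have "ramp g (Abs_longray (g, c)) = c" by (simp add: ramp_def)
    then show "\<exists>z. ramp g z = c" by blast
  qed
  then show ?thesis using continuous_on_subset by blast
qed

text \<open>
  Countably many bounded coordinates are combined with summable positive weights, so that the sum
  is continuous and strictly increasing in every coordinate.
\<close>

definition dyadic :: "(nat \<Rightarrow> real) \<Rightarrow> real"
  where "dyadic t = (\<Sum>n. (1/2) ^ Suc n * t n)"

lemma summable_dyadic:
  assumes "\<And>n. 0 \<le> t n" "\<And>n. t n \<le> 1"
  shows "summable (\<lambda>n. (1/2) ^ Suc n * t n :: real)"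
proof (rule summable_comparison_test')
  show "summable (\<lambda>n. (1/2) ^ n :: real)" by (simp add: summable_geometric)
  show "norm ((1/2) ^ Suc n * t n) \<le> (1/2) ^ n" if "0 \<le> n" for n
    using assms[of n] by (simp add: mult_le_one abs_mult mult.commute[of _ "t n"]) 
qed

lemma dyadic_mono:
  assumes "\<And>n. 0 \<le> s n" "\<And>n. s n \<le> t n" "\<And>n. t n \<le> 1"
  shows "dyadic s \<le> dyadic t"
  unfolding dyadic_def using assms
  by (intro suminf_le summable_dyadic mult_left_mono) (auto intro: order_trans)

text \<open>
  All terms of the difference series are nonnegative and the one at \<open>m\<close> is positive.
\<close>

lemma dyadic_strict_mono:
  assumes st: "\<And>n. 0 \<le> s n" "\<And>n. s n \<le> t n" "\<And>n. t n \<le> 1" and "s m < t m"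
  shows "dyadic s < dyadic t"
proof -
  have sum: "summable (\<lambda>n. (1/2) ^ Suc n * s n)" "summable (\<lambda>n. (1/2) ^ Suc n * t n)"
  proof -
    have "0 \<le> t n" "s n \<le> 1" for n using st[of n] by linarith+
    then show "summable (\<lambda>n. (1/2) ^ Suc n * s n)" "summable (\<lambda>n. (1/2) ^ Suc n * t n)"
      using st summable_dyadic by blast+
  qed
  have "0 < (\<Sum>n. (1/2) ^ Suc n * t n - (1/2) ^ Suc n * s n)"
    by (rule suminf_pos2[of _ m]) (use assms sum in \<open>auto intro!: summable_diff mult_left_mono\<close>)
  then show ?thesis using suminf_diff[OF sum(2,1)] by (simp add: dyadic_def)
qed

lemma dyadic_0 [simp]: "dyadic (\<lambda>n. 0) = 0"
  by (simp add: dyadic_def)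

lemma dyadic_bounds:
  assumes "\<And>n. 0 \<le> t n" "\<And>n. t n \<le> 1"
  shows "0 \<le> dyadic t" "dyadic t \<le> 1"
proof -
  show "0 \<le> dyadic t" using dyadic_mono[of "\<lambda>n. 0" t] assms by simp
  have "dyadic t \<le> dyadic (\<lambda>n. 1)" using assms by (intro dyadic_mono) auto
  also have "dyadic (\<lambda>n. 1) = 1"
    unfolding dyadic_def using sums_unique[OF power_half_series] by simp
  finally show "dyadic t \<le> 1" .
qed

lemma dyadic_add:
  assumes "\<And>n. 0 \<le> s n" "\<And>n. s n \<le> 1" "\<And>n. 0 \<le> t n" "\<And>n. t n \<le> 1"
  shows "dyadic s + dyadic t = dyadic (\<lambda>n. s n + t n)"
  unfolding dyadic_def using suminf_add[OF summable_dyadic[of s] summable_dyadic[of t]] assms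
  by (simp add: distrib_left)

lemma continuous_on_dyadic:
  fixes t :: "nat \<Rightarrow> 'a :: topological_space \<Rightarrow> real"
  assumes "\<And>n. continuous_on A (t n)" "\<And>n x. x \<in> A \<Longrightarrow> 0 \<le> t n x" "\<And>n x. x \<in> A \<Longrightarrow> t n x \<le> 1"
  shows "continuous_on A (\<lambda>x. dyadic (\<lambda>n. t n x))"
  unfolding dyadic_def
proof (rule uniform_limit_theorem)
  show "uniform_limit A (\<lambda>N x. \<Sum>n<N. (1/2) ^ Suc n * t n x) (\<lambda>x. \<Sum>n. (1/2) ^ Suc n * t n x) sequentially"
  proof (rule Weierstrass_m_test)
    show "norm ((1/2) ^ Suc n * t n x) \<le> (1/2) ^ n" if "x \<in> A" for n x
      using assms(2,3)[OF that, of n] by (simp add: mult_le_one abs_mult mult.commute[of _ "t n x"])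
    show "summable (\<lambda>n. (1/2) ^ n :: real)" by (simp add: summable_geometric)
  qed
  show "\<forall>\<^sub>F N in sequentially. continuous_on A (\<lambda>x. \<Sum>n<N. (1/2) ^ Suc n * t n x)"
    by (intro always_eventually allI continuous_intros assms)
qed simp

text \<open>
  An enumeration with repetitions; repeated elements only increase their total weight.
\<close>

definition enum_upto :: "omega1 \<Rightarrow> nat \<Rightarrow> omega1"
  where "enum_upto a = from_nat_into {..a}"

lemma range_enum_upto: "range (enum_upto a) = {..a}"
  unfolding enum_upto_def by (rule range_from_nat_into) (auto simp: countable_atMost_omega1)

text \<open>
  A continuous embedding of the initial segment up to \<open>a\<close> into the unit interval; it is
  constant beyond the block of \<open>a\<close>.
\<close>

definition scale :: "omega1 \<Rightarrow> longray \<Rightarrow> real"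
  where "scale a x = dyadic (\<lambda>n. ramp (enum_upto a n) x)"

lemma scale_bounds: "0 \<le> scale a x" "scale a x \<le> 1"
  unfolding scale_def by (auto intro!: dyadic_bounds ramp_bounds)

lemma scale_mono: "x \<le> y \<Longrightarrow> scale a x \<le> scale a y"
  unfolding scale_def by (intro dyadic_mono ramp_bounds ramp_mono)

text \<open>
  Two different points are separated by the ramp over the block of the smaller one, and this ramp
  occurs in the sum because the block is at most \<open>a\<close>.
\<close>

lemma scale_strict_mono:
  assumes "x < y" "x \<le> vertex a"
  shows "scale a x < scale a y"
proof -
  have "block x \<le> a" using block_mono[OF assms(2)] by simp
  then obtain m where m: "enum_upto a m = block x" using range_enum_upto[of a] by (metis UNIV_I atMost_iff imageE)
  show ?thesis unfolding scale_def
    by (rule dyadic_strict_mono[of _ _ m])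
      (use assms ramp_block_less m in \<open>auto intro!: ramp_bounds ramp_mono\<close>)
qed

lemma scale_inj:
  assumes "scale a x = scale a y" "x \<le> vertex a" "y \<le> vertex a"
  shows "x = y"
  using assms scale_strict_mono[of x y a] scale_strict_mono[of y x a]
  by (metis less_irrefl neq_iff)

lemma scale_origin [simp]: "scale a origin = 0"
proof -
  have "ramp g origin = 0" for g
    using offset_vertex Least_le[of "\<lambda>a. True" g]
    by (auto simp: ramp_def origin_def)
  then show ?thesis by (simp add: scale_def)
qed

lemma continuous_on_scale: "continuous_on A (scale a)"
  unfolding scale_def
  by (intro continuous_on_dyadic continuous_on_ramp ramp_bounds)

section \<open>The layered octant\<close>

text \<open>
  The three components are the position \<open>x\<close>, the level \<open>v\<close> and the family of depths
  \<open>z\<close> in the octants inserted at the ordinal levels.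
\<close>

type_synonym point = "longray \<times> longray \<times> (omega1 \<Rightarrow> longray)"

abbreviation pos :: "point \<Rightarrow> longray" where "pos p \<equiv> fst p"
abbreviation lev :: "point \<Rightarrow> longray" where "lev p \<equiv> fst (snd p)"
abbreviation dep :: "point \<Rightarrow> omega1 \<Rightarrow> longray" where "dep p \<equiv> snd (snd p)"

lemma continuous_on_dep [continuous_intros]: "continuous_on A (\<lambda>p :: point. dep p g)"
  by (rule continuous_on_compose2[OF continuous_on_product_coordinates[of g]])
    (intro continuous_on_snd continuous_on_id, simp)

text \<open>
  The last two conditions say that a depth moves only at its own level: it is minimal once that
  level has been passed and maximal before that level is reached. The maximum with
  \<open>vertex g\<close> freezes the depth of \<open>g\<close> at positions where the octant of \<open>g\<close> has not yet
  begun.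
\<close>

definition layers :: "point set"
  where "layers = {p. lev p \<le> pos p \<and>
     (\<forall>g. vertex g \<le> dep p g \<and> dep p g \<le> max (pos p) (vertex g) \<and>
        (lev p \<le> vertex g \<or> dep p g = vertex g) \<and>
        (vertex g \<le> lev p \<or> dep p g = max (pos p) (vertex g)))}"

lemma layersD:
  assumes "p \<in> layers"
  shows "lev p \<le> pos p" "vertex g \<le> dep p g" "dep p g \<le> max (pos p) (vertex g)"
    "vertex g < lev p \<Longrightarrow> dep p g = vertex g"
    "lev p < vertex g \<Longrightarrow> dep p g = max (pos p) (vertex g)"
    "vertex g < dep p g \<Longrightarrow> lev p \<le> vertex g"
    "dep p g < pos p \<Longrightarrow> vertex g \<le> lev p"
  using assms unfolding layers_def mem_Collect_eq
  by (meson, meson, meson, meson not_less, meson not_less, metis less_irrefl,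
      metis less_irrefl max.cobounded1 not_less)

lemma closed_layers: "closed layers"
  unfolding layers_def
  by (intro closed_Collect_conj closed_Collect_all closed_Collect_disj closed_Collect_le
      closed_Collect_eq continuous_intros)

definition up_to :: "omega1 \<Rightarrow> point set"
  where "up_to a = {p \<in> layers. pos p \<le> vertex a}"

definition below :: "omega1 \<Rightarrow> point set"
  where "below a = {p \<in> layers. pos p < vertex a}"

lemma up_to_subset: "up_to a \<subseteq> layers" and below_subset: "below a \<subseteq> layers"
  and below_up_to: "below a \<subseteq> up_to a"
  by (auto simp: up_to_def below_def)

lemma closed_up_to: "closed (up_to a)"
  unfolding up_to_def Collect_conj_eq[of "\<lambda>p. p \<in> layers"]
  by (intro closed_Int closed_Collect_le continuous_intros) (simp add: closed_layers)

text \<open>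
  A closed subset of a product of compact intervals.
\<close>

lemma compact_up_to: "compact (up_to a)"
proof -
  define Z where "Z = (\<Pi>\<^sub>E g\<in>(UNIV :: omega1 set). {vertex g..max (vertex a) (vertex g)})"
  have "compactin (product_topology (\<lambda>_. euclidean) UNIV) Z"
    unfolding Z_def compactin_PiE by (simp add: compact_Icc_linear_continuum)
  then have "compact Z" by (simp add: euclidean_product_topology)
  then have "compact ({origin..vertex a} \<times> {origin..vertex a} \<times> Z)"
    by (intro compact_Times compact_Icc_linear_continuum)
  moreover have "up_to a \<subseteq> {origin..vertex a} \<times> {origin..vertex a} \<times> Z"
  proof
    fix p assume p: "p \<in> up_to a"
    then have "p \<in> layers" "pos p \<le> vertex a" by (auto simp: up_to_def)
    then have "lev p \<le> vertex a" "\<And>g. dep p g \<le> max (vertex a) (vertex g)"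
      using layersD(1,3)[of p] by (auto intro: order_trans simp: le_max_iff_disj)
    then show "p \<in> {origin..vertex a} \<times> {origin..vertex a} \<times> Z"
      using \<open>p \<in> layers\<close> \<open>pos p \<le> vertex a\<close> layersD(2)[of p]
      by (auto simp: Z_def mem_Times_iff)
  qed
  ultimately show ?thesis
    using closed_up_to compact_Int_closed inf.absorb_iff2 by metis
qed

lemma layers_below_ex: "p \<in> layers \<Longrightarrow> \<exists>a. p \<in> below a"
  using longray_less_vertex[of "pos p"] by (auto simp: below_def)

text \<open>
  The point at position \<open>x\<close> and level \<open>v\<close>; the depth \<open>w\<close> is used only if \<open>v\<close> is an
  ordinal level.
\<close>

definition layer_point :: "longray \<Rightarrow> longray \<Rightarrow> longray \<Rightarrow> point"
  where "layer_point x v w =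
    (x, v, \<lambda>g. if vertex g < v then vertex g else if vertex g = v then w else max x (vertex g))"

lemma layer_point_sel [simp]: "pos (layer_point x v w) = x" "lev (layer_point x v w) = v" "v = vertex g \<Longrightarrow> dep (layer_point x v w) g = w"
  by (auto simp: layer_point_def)

lemma layer_point_in_layers:
  assumes "v \<le> x" "\<And>g. v = vertex g \<Longrightarrow> v \<le> w \<and> w \<le> x"
  shows "layer_point x v w \<in> layers"
  using assms by (auto simp: layers_def layer_point_def le_max_iff_disj not_less)

text \<open>
  The linear order of a fibre of the position: the level increases, and within an octant the depth
  decreases from the edge \<open>z = x\<close> to the edge \<open>z = g\<close>.
\<close>

definition fibre_less :: "point \<Rightarrow> point \<Rightarrow> bool" (infix "\<triangleleft>" 50)
  where "p \<triangleleft> q \<longleftrightarrow> pos p = pos q \<and>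
     (lev p < lev q \<or> lev p = lev q \<and> (\<exists>g. lev p = vertex g \<and> dep q g < dep p g))"

text \<open>
  Away from its own level a depth is forced, so position, level and at most one depth determine a
  point.
\<close>

lemma layers_eqI:
  assumes "p \<in> layers" "q \<in> layers" "pos p = pos q" "lev p = lev q"
    and "\<And>g. lev p = vertex g \<Longrightarrow> dep p g = dep q g"
  shows "p = q"
proof -
  have "dep p g = dep q g" for g
    using layersD(4,5)[OF assms(1), of g] layersD(4,5)[OF assms(2), of g] assms(3-5)
    by (metis not_less_iff_gr_or_eq)
  then show ?thesis using assms by (simp add: prod_eq_iff fun_eq_iff)
qed

lemma fibre_less_linear:
  assumes "p \<in> layers" "q \<in> layers" "pos p = pos q"
  shows "p \<triangleleft> q \<or> p = q \<or> q \<triangleleft> p"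
  using layers_eqI[OF assms] assms(3) unfolding fibre_less_def
  by (metis not_less_iff_gr_or_eq)

lemma fibre_less_dep:
  assumes "p \<in> layers" "q \<in> layers" "p \<triangleleft> q"
  shows "dep q g \<le> dep p g"
proof -
  consider "vertex g < lev q" | "lev p < vertex g" | "lev p = lev q" "lev p = vertex g"
    using assms(3) by (force simp: fibre_less_def)
  then show ?thesis
  proof cases
    case 1
    then show ?thesis using layersD(2)[OF assms(1)] layersD(4)[OF assms(2)] by metis
  next
    case 2
    then show ?thesis
      using layersD(5)[OF assms(1)] layersD(3)[OF assms(2)] assms(3) by (metis fibre_less_def)
  next
    case 3
    then show ?thesis using assms(3) by (auto simp: fibre_less_def)
  qed
qed

lemma fibre_less_dense:
  assumes "p \<in> layers" "q \<in> layers" "p \<triangleleft> q"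
  shows "\<exists>r\<in>layers. p \<triangleleft> r \<and> r \<triangleleft> q"
proof (cases "lev p < lev q")
  case True
  then obtain v where v: "lev p < v" "v < lev q" using dense by blast
  then have "v \<le> pos p" using layersD(1)[OF assms(2)] assms(3) by (simp add: fibre_less_def)
  then show ?thesis using v assms(3)
    by (intro bexI[of _ "layer_point (pos p) v (pos p)"] layer_point_in_layers) (auto simp: fibre_less_def)
next
  case False
  then obtain g where g: "pos p = pos q" "lev p = vertex g" "lev q = vertex g" "dep q g < dep p g"
    using assms(3) unfolding fibre_less_def by metis
  then obtain w where w: "dep q g < w" "w < dep p g" using dense by blast
  have "vertex g \<le> pos p" using layersD(1)[OF assms(1)] g by simp
  moreover have "vertex g \<le> w" "w \<le> pos p"
    using w layersD(2)[OF assms(2), of g] layersD(3)[OF assms(1), of g] \<open>vertex g \<le> pos p\<close>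
    by (auto simp: max_def)
  ultimately show ?thesis using w g
    by (intro bexI[of _ "layer_point (pos p) (vertex g) w"] layer_point_in_layers) (auto simp: fibre_less_def)
qed

section \<open>Planar charts\<close>

text \<open>
  The length of the fibre over \<open>x\<close> when levels and depths are measured by \<open>scale a\<close> and
  the octants carry dyadic weights.
\<close>

definition fibre_length :: "omega1 \<Rightarrow> longray \<Rightarrow> real"
  where "fibre_length a x = scale a x +
     dyadic (\<lambda>n. scale a (max x (vertex (enum_upto a n))) - scale a (vertex (enum_upto a n)))"

text \<open>
  The length of the part of the fibre below \<open>p\<close>: every octant that has been passed contributes
  its full depth range, and the octant of \<open>p\<close> the part already traversed.
\<close>

definition from_bottom :: "omega1 \<Rightarrow> point \<Rightarrow> real"
  where "from_bottom a p = scale a (lev p) +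
     dyadic (\<lambda>n. scale a (max (pos p) (vertex (enum_upto a n))) - scale a (dep p (enum_upto a n)))"

definition from_top :: "omega1 \<Rightarrow> point \<Rightarrow> real"
  where "from_top a p = scale a (pos p) - scale a (lev p) +
     dyadic (\<lambda>n. scale a (dep p (enum_upto a n)) - scale a (vertex (enum_upto a n)))"

lemma scale_diff_bounds:
  "x \<le> y \<Longrightarrow> 0 \<le> scale a y - scale a x" "scale a y - scale a x \<le> 1"
  using scale_mono[of x y a] scale_bounds[of a x] scale_bounds[of a y] by auto

lemma continuous_on_scale_compose [continuous_intros]:
  "continuous_on A f \<Longrightarrow> continuous_on A (\<lambda>x. scale a (f x))"
  using continuous_on_compose2[OF continuous_on_scale[of UNIV a]] by blast

lemma continuous_on_from_bottom: "continuous_on layers (from_bottom a)"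
  unfolding from_bottom_def
  by (intro continuous_intros continuous_on_dyadic scale_diff_bounds layersD)

lemma continuous_on_from_top: "continuous_on layers (from_top a)"
  unfolding from_top_def
  by (intro continuous_intros continuous_on_dyadic scale_diff_bounds layersD)

lemma continuous_on_fibre_length: "continuous_on A (fibre_length a)"
  unfolding fibre_length_def
  by (intro continuous_intros continuous_on_dyadic scale_diff_bounds) simp

lemma from_bottom_add_from_top:
  assumes "p \<in> layers"
  shows "from_bottom a p + from_top a p = fibre_length a (pos p)"
  unfolding from_bottom_def from_top_def fibre_length_def
  using dyadic_add[of "\<lambda>n. scale a (max (pos p) (vertex (enum_upto a n))) - scale a (dep p (enum_upto a n))"
      "\<lambda>n. scale a (dep p (enum_upto a n)) - scale a (vertex (enum_upto a n))"]
    layersD(2,3)[OF assms]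
  by (simp add: scale_diff_bounds(2) scale_mono)

lemma from_bottom_nonneg: "p \<in> layers \<Longrightarrow> 0 \<le> from_bottom a p"
  unfolding from_bottom_def
  by (intro add_nonneg_nonneg scale_bounds dyadic_bounds scale_diff_bounds layersD)

lemma from_top_nonneg: "p \<in> layers \<Longrightarrow> 0 \<le> from_top a p"
  unfolding from_top_def
  by (intro add_nonneg_nonneg scale_bounds dyadic_bounds scale_diff_bounds layersD)

text \<open>
  The summand \<open>scale a x\<close> alone is strictly increasing; the octants contribute a weakly
  increasing amount.
\<close>

lemma fibre_length_strict_mono:
  assumes "x < y" "x \<le> vertex a"
  shows "fibre_length a x < fibre_length a y"
proof -
  have "dyadic (\<lambda>n. scale a (max x (vertex (enum_upto a n))) - scale a (vertex (enum_upto a n)))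
    \<le> dyadic (\<lambda>n. scale a (max y (vertex (enum_upto a n))) - scale a (vertex (enum_upto a n)))"
    using assms(1) by (intro dyadic_mono scale_diff_bounds diff_right_mono scale_mono max.mono) auto
  then show ?thesis using scale_strict_mono[OF assms] by (simp add: fibre_length_def)
qed

lemma fibre_length_origin [simp]: "fibre_length a origin = 0"
  by (simp add: fibre_length_def max_absorb2)

text \<open>
  Moving up a fibre raises the level or lowers the depth at the current level, and no other depth
  increases. A current level \<open>g \<le> a\<close> occurs in the enumeration, so a change of its depth is
  seen by the sum.
\<close>

lemma from_bottom_strict_mono:
  assumes "p \<in> layers" "q \<in> layers" "p \<triangleleft> q" "pos p \<le> vertex a"
  shows "from_bottom a p < from_bottom a q"
proof -
  let ?t = "\<lambda>p n. scale a (max (pos p) (vertex (enum_upto a n))) - scale a (dep p (enum_upto a n))"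
  have pq: "pos q = pos p" using assms(3) by (simp add: fibre_less_def)
  have t: "0 \<le> ?t p n" "?t p n \<le> ?t q n" "?t q n \<le> 1" for n
    using scale_diff_bounds layersD(3)[OF assms(1)] fibre_less_dep[OF assms(1-3)] scale_mono pq
    by auto
  show ?thesis
  proof (cases "lev p < lev q")
    case True
    have "lev p \<le> vertex a" using layersD(1)[OF assms(1)] assms(4) by order
    then have "scale a (lev p) < scale a (lev q)" using True scale_strict_mono by blast
    moreover have "dyadic (?t p) \<le> dyadic (?t q)" using t by (intro dyadic_mono)
    ultimately show ?thesis unfolding from_bottom_def by linarith
  next
    case False
    then obtain g where g: "lev p = vertex g" "lev q = vertex g" "dep q g < dep p g"
      using assms(3) unfolding fibre_less_def by metis
    then have gx: "vertex g \<le> pos p" using layersD(1)[OF assms(1)] by simp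
    then have "vertex g \<le> vertex a" using assms(4) by order
    then have "g \<in> range (enum_upto a)" by (simp add: range_enum_upto)
    then obtain m where m: "enum_upto a m = g" by blast
    have "dep q g \<le> vertex a"
      using g(3) layersD(3)[OF assms(1), of g] gx assms(4) by (simp add: max_absorb1)
    then have "scale a (dep q g) < scale a (dep p g)" using g scale_strict_mono by blast
    then have "dyadic (?t p) < dyadic (?t q)"
      using t pq m by (intro dyadic_strict_mono[of _ _ m]) auto
    then show ?thesis using g unfolding from_bottom_def by simp
  qed
qed

text \<open>
  If the value \<open>t\<close> were skipped, compactness would give a highest point below it and a lowest
  point above it, but the order of a fibre is dense.
\<close>

lemma fibre_ivt:
  assumes "x \<le> vertex a" "0 \<le> t" "t \<le> fibre_length a x"
  shows "\<exists>p\<in>layers. pos p = x \<and> from_bottom a p = t"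
proof (rule ccontr)
  assume contra: "\<not> ?thesis"
  define fib where "fib = {p \<in> up_to a. pos p = x}"
  have fibI: "p \<in> fib \<longleftrightarrow> p \<in> layers \<and> pos p = x" for p
    using assms(1) by (auto simp: fib_def up_to_def)
  have cpt: "compact {p \<in> fib. P p}" if "closed {p. p \<in> layers \<and> P p}" for P
  proof -
    have "{p \<in> fib. P p} = (up_to a \<inter> {p. pos p = x}) \<inter> {p. p \<in> layers \<and> P p}"
      by (auto simp: fib_def up_to_def)
    moreover have "compact (up_to a \<inter> {p. pos p = x})"
      by (intro compact_Int_closed compact_up_to closed_Collect_eq continuous_intros)
    ultimately show ?thesis using compact_Int_closed[OF _ that] by simp
  qed
  have cl: "closed {p. p \<in> layers \<and> from_bottom a p \<le> t}" "closed {p. p \<in> layers \<and> t \<le> from_bottom a p}"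
    using continuous_on_closed_Collect_le[OF continuous_on_from_bottom _ closed_layers, of "\<lambda>_. t" a]
      continuous_on_closed_Collect_le[OF _ continuous_on_from_bottom closed_layers, of "\<lambda>_. t" a]
    by simp_all
  have b: "layer_point x origin x \<in> layers" "from_bottom a (layer_point x origin x) = 0"
  proof -
    show "layer_point x origin x \<in> layers" by (rule layer_point_in_layers) auto
    have "dep (layer_point x origin x) g = max x (vertex g)" for g
      using leD[OF origin_le[of "vertex g"]] by (auto simp: layer_point_def max_absorb1)
    then show "from_bottom a (layer_point x origin x) = 0" by (simp add: from_bottom_def)
  qed
  have m: "layer_point x x x \<in> layers" "from_bottom a (layer_point x x x) = fibre_length a x"
  proof -
    show "layer_point x x x \<in> layers" by (rule layer_point_in_layers) auto
    have "dep (layer_point x x x) g = vertex g" for g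
      by (auto simp: layer_point_def max_absorb2 not_less)
    then show "from_bottom a (layer_point x x x) = fibre_length a x" by (simp add: from_bottom_def fibre_length_def)
  qed
  have cont: "continuous_on {p \<in> fib. P p} (from_bottom a)" for P
    by (rule continuous_on_subset[OF continuous_on_from_bottom]) (simp add: fibI subset_eq)
  have "\<exists>p\<in>{p \<in> fib. from_bottom a p \<le> t}. \<forall>q\<in>{p \<in> fib. from_bottom a p \<le> t}. from_bottom a q \<le> from_bottom a p"
  proof (rule continuous_attains_sup[OF cpt[OF cl(1)] _ cont])
    have "layer_point x origin x \<in> {p \<in> fib. from_bottom a p \<le> t}" using b assms by (simp add: fibI)
    then show "{p \<in> fib. from_bottom a p \<le> t} \<noteq> {}" by blast
  qed
  then obtain p where p: "p \<in> fib" "from_bottom a p \<le> t" "\<And>q. q \<in> fib \<Longrightarrow> from_bottom a q \<le> t \<Longrightarrow> from_bottom a q \<le> from_bottom a p"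
    by auto
  have "\<exists>q\<in>{p \<in> fib. t \<le> from_bottom a p}. \<forall>r\<in>{p \<in> fib. t \<le> from_bottom a p}. from_bottom a q \<le> from_bottom a r"
  proof (rule continuous_attains_inf[OF cpt[OF cl(2)] _ cont])
    have "layer_point x x x \<in> {p \<in> fib. t \<le> from_bottom a p}" using m assms by (simp add: fibI)
    then show "{p \<in> fib. t \<le> from_bottom a p} \<noteq> {}" by blast
  qed
  then obtain q where q: "q \<in> fib" "t \<le> from_bottom a q" "\<And>r. r \<in> fib \<Longrightarrow> t \<le> from_bottom a r \<Longrightarrow> from_bottom a q \<le> from_bottom a r"
    by auto
  have "from_bottom a p \<noteq> t" "from_bottom a q \<noteq> t" using p(1) q(1) contra fibI by blast+
  then have lt: "from_bottom a p < t" "t < from_bottom a q" using p(2) q(2) by linarith+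
  have S: "p \<in> layers" "q \<in> layers" "pos p = x" "pos q = x" using p(1) q(1) fibI by auto
  have "p \<triangleleft> q"
    using fibre_less_linear[of p q] from_bottom_strict_mono[of q p a] S lt assms(1) by fastforce
  then obtain r where r: "r \<in> layers" "p \<triangleleft> r" "r \<triangleleft> q"
    using fibre_less_dense S by blast
  then have "r \<in> fib" using S by (simp add: fibI fibre_less_def)
  moreover have "from_bottom a p < from_bottom a r" "from_bottom a r < from_bottom a q"
    using r S assms(1) \<open>r \<in> fib\<close> fibI by (simp_all add: from_bottom_strict_mono)
  ultimately show False using p(3)[of r] q(3)[of r] by linarith
qed

text \<open>
  The map \<open>(l, h) \<mapsto> (l - h, min l h)\<close> straightens the corner of the quadrant and carries it onto
  the closed upper half plane.
\<close>

definition chart :: "omega1 \<Rightarrow> point \<Rightarrow> real \<times> real"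
  where "chart a p = (from_bottom a p - from_top a p, min (from_bottom a p) (from_top a p))"

definition chart_image :: "omega1 \<Rightarrow> (real \<times> real) set"
  where "chart_image a = {q. 0 \<le> snd q \<and> \<bar>fst q\<bar> + 2 * snd q < fibre_length a (vertex a)}"

text \<open>
  The chart determines both distances, their sum is the length of the fibre and hence determines
  the position, and on one fibre the distance from the bottom is injective.
\<close>

lemma inj_on_chart: "inj_on (chart a) (up_to a)"
proof (rule inj_onI)
  fix p q assume pq: "p \<in> up_to a" "q \<in> up_to a" and eq: "chart a p = chart a q"
  then have S: "p \<in> layers" "q \<in> layers" "pos p \<le> vertex a" "pos q \<le> vertex a" by (auto simp: up_to_def)
  have from_bottom: "from_bottom a p = from_bottom a q" and "from_top a p = from_top a q" using eq by (auto simp: chart_def min_def split: if_splits)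
  then have "fibre_length a (pos p) = fibre_length a (pos q)" using from_bottom_add_from_top S by metis
  then have "pos p = pos q"
    using fibre_length_strict_mono[of "pos p" "pos q" a] fibre_length_strict_mono[of "pos q" "pos p" a] S
    by (metis less_irrefl neq_iff)
  then show "p = q"
    using fibre_less_linear[of p q] from_bottom_strict_mono[of p q a] from_bottom_strict_mono[of q p a] S from_bottom by fastforce
qed

lemma chart_below: "chart a ` below a = chart_image a"
proof (intro equalityI subsetI)
  fix q assume "q \<in> chart a ` below a"
  then obtain p where p: "p \<in> layers" "pos p < vertex a" "q = chart a p" by (auto simp: below_def)
  have "fibre_length a (pos p) < fibre_length a (vertex a)" using p fibre_length_strict_mono by simp
  then show "q \<in> chart_image a"
    using from_bottom_add_from_top[of p a] from_bottom_nonneg[of p a] from_top_nonneg[of p a] p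
    by (auto simp: chart_image_def chart_def min_def)
next
  fix q assume q: "q \<in> chart_image a"
  obtain u w where uw: "q = (u, w)" by force
  define l h where "l = w + max u 0" and "h = w + max (-u) 0"
  have lh: "0 \<le> l" "0 \<le> h" "l + h < fibre_length a (vertex a)" "q = (l - h, min l h)"
    using q uw by (auto simp: chart_image_def l_def h_def)
  obtain x where x: "origin \<le> x" "x \<le> vertex a" "fibre_length a x = l + h"
    using IVT'[of "fibre_length a" origin "l + h" "vertex a"] lh continuous_on_fibre_length by auto
  then have "x < vertex a" using lh(3) by (metis less_irrefl order_le_less)
  obtain p where p: "p \<in> layers" "pos p = x" "from_bottom a p = l"
    using fibre_ivt[of x a l] x lh by auto
  then have "from_top a p = h" using from_bottom_add_from_top[of p a] x by simp
  then have "chart a p = q" using p lh by (simp add: chart_def)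
  then show "q \<in> chart a ` below a" using p \<open>x < vertex a\<close> by (auto simp: below_def)
qed

text \<open>
  A continuous injection of the compact set \<open>up_to a\<close> into the plane is a homeomorphism onto its
  image; restrict it to the open part.
\<close>

lemma below_homeomorphism: "\<exists>\<psi>. homeomorphism (below a) (chart_image a) (chart a) \<psi>"
proof -
  have "continuous_on (up_to a) (chart a)"
    unfolding chart_def
    by (intro continuous_intros continuous_on_subset[OF continuous_on_from_bottom up_to_subset]
        continuous_on_subset[OF continuous_on_from_top up_to_subset])
  then obtain \<psi> where "homeomorphism (up_to a) (chart a ` up_to a) (chart a) \<psi>"
    using homeomorphism_compact[OF compact_up_to _ refl inj_on_chart] by blast
  then have "homeomorphism (below a) (chart_image a) (chart a) \<psi>"
    by (rule homeomorphism_of_subsets) (use below_up_to chart_below in auto)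
  then show ?thesis by blast
qed

section \<open>The layered octant is an omega-bounded Type I surface\<close>

lemma homeomorphism_imp_homeomorphic_space:
  assumes "homeomorphism S T f g"
  shows "top_of_set S homeomorphic_space top_of_set T"
  unfolding homeomorphic_space_def homeomorphic_maps_def
  using assms by (intro exI[of _ f] exI[of _ g]) (auto simp: homeomorphism_def)

text \<open>
  An increasing union of sets that are homeomorphic to convex triangles and share the
  point over the origin.
\<close>

lemma connected_layers: "connected layers"
proof -
  have "layers = (\<Union>a\<in>{LEAST b. True<..}. below a)"
  proof (intro equalityI subsetI)
    fix p assume "p \<in> layers"
    then obtain a where "p \<in> below a" using layers_below_ex by blast
    moreover obtain b where "a < b" using omega1_gt_ex by blast
    moreover have "(LEAST b. True) < b"
      using \<open>a < b\<close> Least_le[of "\<lambda>_. True" a] by (simp add: le_less_trans)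
    ultimately show "p \<in> (\<Union>a\<in>{LEAST b. True<..}. below a)"
      by (auto simp: below_def intro!: bexI[of _ b] dest: less_trans[of _ "vertex a" "vertex b"])
  qed (auto simp: below_def)
  moreover have "connected (\<Union>a\<in>{LEAST b. True<..}. below a)"
  proof (rule connected_Union)
    fix s assume "s \<in> below ` {LEAST b. True<..}"
    then obtain a where s: "s = below a" by blast
    obtain \<psi> where \<psi>: "homeomorphism (below a) (chart_image a) (chart a) \<psi>"
      using below_homeomorphism by blast
    have "convex (chart_image a)"
    proof (rule convexI)
      fix x y :: "real \<times> real" and u v :: real
      assume xy: "x \<in> chart_image a" "y \<in> chart_image a" and uv: "0 \<le> u" "0 \<le> v" "u + v = 1"
      have "\<bar>u * fst x + v * fst y\<bar> + 2 * (u * snd x + v * snd y)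
        \<le> u * (\<bar>fst x\<bar> + 2 * snd x) + v * (\<bar>fst y\<bar> + 2 * snd y)"
        using abs_triangle_ineq[of "u * fst x" "v * fst y"] uv
        by (simp add: abs_mult algebra_simps)
      also have "\<dots> < fibre_length a (vertex a)"
        using xy uv by (intro convex_bound_lt) (auto simp: chart_image_def)
      finally show "u *\<^sub>R x + v *\<^sub>R y \<in> chart_image a"
        using xy uv by (auto simp: chart_image_def)
    qed
    then have "connected (\<psi> ` chart_image a)"
      using \<psi> by (intro connected_continuous_image convex_connected) (auto simp: homeomorphism_def)
    then show "connected s" using \<psi> s by (simp add: homeomorphism_def)
  next
    have "layer_point origin origin origin \<in> below a" if "(LEAST b. True) < a" for a
      using that by (auto simp: below_def layer_point_in_layers) (simp add: origin_def)
    then show "\<Inter>(below ` {LEAST b. True<..}) \<noteq> {}" by blast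
  qed
  ultimately show ?thesis by simp
qed

abbreviation layered :: "point topology"
  where "layered \<equiv> top_of_set layers"

lemma openin_below: "openin layered (below a)"
proof -
  have "open {p :: point. pos p < vertex a}"
    by (intro open_Collect_less continuous_intros)
  then show ?thesis by (auto simp: below_def openin_open)
qed

lemma Hausdorff_layered: "Hausdorff_space layered"
proof -
  have "Hausdorff_space (euclidean :: longray topology)"
    unfolding Hausdorff_space_def disjnt_def using hausdorff by simp blast
  then have "Hausdorff_space (euclidean :: (omega1 \<Rightarrow> longray) topology)"
    unfolding euclidean_product_topology[symmetric]
    by (simp add: Hausdorff_space_product_topology)
  then have "Hausdorff_space (prod_topology (euclidean :: longray topology)
      (prod_topology (euclidean :: longray topology) (euclidean :: (omega1 \<Rightarrow> longray) topology)))"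
    using \<open>Hausdorff_space (euclidean :: longray topology)\<close>
    by (simp only: Hausdorff_space_prod_topology) simp
  then have "Hausdorff_space (euclidean :: point topology)" by simp
  then show ?thesis by (rule Hausdorff_space_subtopology)
qed

lemma surface_layered: "surface layered"
  unfolding surface_def
proof (intro conjI ballI)
  show "Hausdorff_space layered" by (rule Hausdorff_layered)
  show "connected_space layered" using connected_layers by (simp add: connected_space_subtopology)
  fix p assume "p \<in> topspace layered"
  then have "p \<in> layers" by simp
  then obtain a where a: "p \<in> below a" using layers_below_ex by blast
  obtain \<psi> where \<psi>: "homeomorphism (below a) (chart_image a) (chart a) \<psi>"
    using below_homeomorphism by blast
  let ?V = "chart_image a"
  have "open {q :: real \<times> real. \<bar>fst q\<bar> + 2 * snd q < fibre_length a (vertex a)}"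
    by (intro open_Collect_less continuous_intros)
  moreover have "?V = {p. 0 \<le> snd p} \<inter> {q. \<bar>fst q\<bar> + 2 * snd q < fibre_length a (vertex a)}"
    by (auto simp: chart_image_def)
  ultimately have "openin half_plane ?V" by (auto simp: half_plane_def openin_open)
  moreover have "subtopology layered (below a) homeomorphic_space subtopology half_plane ?V"
  proof -
    have "subtopology layered (below a) = top_of_set (below a)"
      by (simp add: subtopology_subtopology below_subset inf.absorb2)
    moreover have "subtopology half_plane ?V = top_of_set ?V"
      unfolding half_plane_def subtopology_subtopology
      by (rule arg_cong[of _ _ top_of_set]) (auto simp: chart_image_def)
    ultimately show ?thesis using homeomorphism_imp_homeomorphic_space[OF \<psi>] by simp
  qed
  ultimately show "\<exists>U V. openin layered U \<and> p \<in> U \<and> openin half_plane V \<and>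
      subtopology layered U homeomorphic_space subtopology half_plane V"
    using openin_below a by blast
qed

lemma closure_of_subset_up_to:
  assumes "A \<subseteq> up_to a"
  shows "layered closure_of A \<subseteq> up_to a"
    and "compactin layered (layered closure_of A)"
proof -
  have "closedin layered (up_to a)"
    using closed_up_to up_to_subset by (auto simp: closedin_closed)
  then show sub: "layered closure_of A \<subseteq> up_to a"
    using assms by (simp add: closure_of_minimal)
  have "compactin layered (up_to a)"
    using compact_up_to up_to_subset by (simp add: compactin_subtopology)
  then show "compactin layered (layered closure_of A)"
    using sub by (rule closed_compactin) (rule closedin_closure_of)
qed

text \<open>
  Countably many positions are bounded; this is what makes the surface \<open>\<omega>\<close>-bounded.
\<close>

lemma countable_subset_up_to:
  assumes "A \<subseteq> layers" "countable A"
  shows "\<exists>a. A \<subseteq> up_to a"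
proof -
  have "countable ((\<lambda>p. block (pos p)) ` A)" using assms by simp
  then obtain b where "\<forall>a\<in>(\<lambda>p. block (pos p)) ` A. a < b"
    using countable_omega1_bounded by presburger
  then have "\<forall>p\<in>A. pos p < vertex b" by (simp add: less_vertex_iff)
  then have "A \<subseteq> up_to b" using assms(1) by (auto simp: up_to_def)
  then show ?thesis by (rule exI)
qed

lemma omega_bounded_layered: "omega_bounded_space layered"
  unfolding omega_bounded_space_def
proof (intro allI impI)
  fix A assume "A \<subseteq> topspace layered \<and> countable A"
  then have "\<exists>a. A \<subseteq> up_to a" by (intro countable_subset_up_to) simp_all
  then obtain a where "A \<subseteq> up_to a" ..
  then show "compactin layered (layered closure_of A)" by (rule closure_of_subset_up_to)
qed

lemma type_I_layered: "type_I layered below"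
  unfolding type_I_def
proof (intro conjI allI impI)
  show "Hausdorff_space layered" by (rule Hausdorff_layered)
  show "topspace layered = (\<Union>a. below a)" using layers_below_ex below_subset by simp blast
  show "openin layered (below a)" for a by (rule openin_below)
  show "Lindelof_space (subtopology layered (layered closure_of below a))" for a
  proof -
    have "compactin layered (layered closure_of below a)"
      by (rule closure_of_subset_up_to(2)[OF below_up_to])
    then show ?thesis
      by (meson compact_imp_Lindelof_space compactin_subspace)
  qed
  show "layered closure_of below a \<subseteq> below b" if "a < b" for a b
  proof -
    have "up_to a \<subseteq> below b" using that by (auto simp: up_to_def below_def intro: le_less_trans)
    then show ?thesis using closure_of_subset_up_to(1)[OF below_up_to] by blast
  qed
  show "\<not> Lindelof_space layered"
  proof
    assume "Lindelof_space layered"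
    moreover have "\<Union>(range below) = topspace layered"
      using layers_below_ex below_subset by simp blast
    moreover have "\<forall>W\<in>range below. openin layered W" using openin_below by blast
    ultimately obtain V where V: "countable V" "V \<subseteq> range below" "\<Union>V = topspace layered"
      unfolding Lindelof_space_def by meson
    obtain I where I: "countable I" "V = below ` I"
      using V countable_subset_image by metis
    obtain b where b: "\<forall>a\<in>I. a < b" using countable_omega1_bounded[OF I(1)] by blast
    have "layer_point (vertex b) (vertex b) (vertex b) \<in> layers" by (rule layer_point_in_layers) auto
    then have "\<exists>a\<in>I. layer_point (vertex b) (vertex b) (vertex b) \<in> below a"
      using V(3) I(2) by auto
    then show False using b by (auto simp: below_def)
  qed
qed

section \<open>Unbounded sequences and their cluster points\<close>

text \<open>
  Unboundedness in the Type I sense, expressed by the position.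
\<close>

definition cofinal :: "point set \<Rightarrow> bool"
  where "cofinal C \<longleftrightarrow> (\<forall>a. \<exists>p\<in>C. vertex a \<le> pos p)"

lemma cofinalD: "cofinal C \<Longrightarrow> \<exists>p\<in>C. vertex a \<le> pos p"
  by (simp add: cofinal_def)

lemma club_layered: "club layered below C \<longleftrightarrow> C \<subseteq> layers \<and> closed C \<and> cofinal C"
proof -
  have "closedin layered C \<longleftrightarrow> C \<subseteq> layers \<and> closed C"
    using closedin_closed_eq[OF closed_layers] by auto
  moreover have "\<not> type_I_bounded below C \<longleftrightarrow> cofinal C" if "C \<subseteq> layers"
    using that by (auto simp: type_I_bounded_def cofinal_def below_def subset_eq not_less)
  ultimately show ?thesis unfolding club_def by blast
qed

lemma continuous_map_layered: "continuous_map layered euclidean f \<longleftrightarrow> continuous_on layers f"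
  by (rule continuous_map_iff_continuous)

lemma closed_layers_le:
  fixes f g :: "point \<Rightarrow> 'b :: linorder_topology"
  assumes "continuous_on layers f" "continuous_on layers g"
  shows "closed {p \<in> layers. f p \<le> g p}"
proof -
  have "closed (layers \<inter> (\<lambda>p. (f p, g p)) -` {(x, y) | x y. x \<le> y})"
    by (intro continuous_closed_preimage continuous_on_Pair assms closed_layers closed_subdiagonal)
  moreover have "layers \<inter> (\<lambda>p. (f p, g p)) -` {(x, y) | x y. x \<le> y} = {p \<in> layers. f p \<le> g p}"
    by auto
  ultimately show ?thesis by simp
qed

lemma closed_layers_eq:
  fixes f g :: "point \<Rightarrow> 'b :: linorder_topology"
  assumes "continuous_on layers f" "continuous_on layers g"
  shows "closed {p \<in> layers. f p = g p}"
proof -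
  have "{p \<in> layers. f p = g p} = {p \<in> layers. f p \<le> g p} \<inter> {p \<in> layers. g p \<le> f p}"
    by auto
  then show ?thesis using closed_Int[OF closed_layers_le[OF assms] closed_layers_le[OF assms(2,1)]] by (simp only:)
qed

text \<open>
  A filter refining the sequence is used in place of a subsequence, because the ambient product
  of uncountably many long rays is not first countable.
\<close>

definition clusters :: "(nat \<Rightarrow> point) \<Rightarrow> point \<Rightarrow> bool"
  where "clusters p q \<longleftrightarrow> (\<exists>G. G \<noteq> bot \<and> G \<le> nhds q \<and> G \<le> filtermap p sequentially)"

lemma clusters_exists:
  assumes "\<And>n. p n \<in> up_to a"
  shows "\<exists>q\<in>up_to a. clusters p q"
proof -
  have "eventually (\<lambda>x. x \<in> up_to a) (filtermap p sequentially)"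
    using assms by (simp add: eventually_filtermap)
  moreover have "filtermap p sequentially \<noteq> bot" by (simp add: filtermap_bot_iff)
  ultimately obtain q where "q \<in> up_to a" "inf (nhds q) (filtermap p sequentially) \<noteq> bot"
    using compact_up_to[of a] unfolding compact_filter by meson
  then show ?thesis unfolding clusters_def by (meson inf_le1 inf_le2)
qed

lemma clusters_closed:
  assumes "clusters p q" "closed C" "\<And>n. p n \<in> C"
  shows "q \<in> C"
proof -
  obtain G where G: "G \<noteq> bot" "G \<le> nhds q" "G \<le> filtermap p sequentially"
    using assms(1) unfolding clusters_def by blast
  have "eventually (\<lambda>x. x \<in> C) (filtermap p sequentially)"
    using assms(3) by (simp add: eventually_filtermap)
  then have "eventually (\<lambda>x. x \<in> C) G" using G(3) by (rule filter_leD[rotated])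
  moreover have "((\<lambda>x. x) \<longlongrightarrow> q) G" using G(2) by (simp add: filterlim_def)
  ultimately show ?thesis by (rule Lim_in_closed_set[OF assms(2) _ G(1)])
qed

text \<open>
  Along the refining filter the values converge both to the value at the cluster point and to the
  limit of the sequence.
\<close>

lemma clusters_tendsto:
  fixes \<phi> :: "point \<Rightarrow> 'b :: t2_space"
  assumes "clusters p q" "\<And>n. p n \<in> layers" "continuous_on layers \<phi>"
    and "(\<lambda>n. \<phi> (p n)) \<longlonglongrightarrow> y"
  shows "\<phi> q = y"
proof -
  have q: "q \<in> layers" using assms(1) closed_layers assms(2) by (rule clusters_closed)
  obtain G where G: "G \<noteq> bot" "G \<le> nhds q" "G \<le> filtermap p sequentially"
    using assms(1) unfolding clusters_def by blast
  have "eventually (\<lambda>x. x \<in> layers) (filtermap p sequentially)"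
    using assms(2) by (simp add: eventually_filtermap)
  then have "eventually (\<lambda>x. x \<in> layers) G" using G(3) by (rule filter_leD[rotated])
  moreover have "((\<lambda>x. x) \<longlongrightarrow> q) G" using G(2) by (simp add: filterlim_def)
  ultimately have "(\<phi> \<longlongrightarrow> \<phi> q) G"
    using continuous_on_tendsto_compose[OF assms(3), of "\<lambda>x. x" q G] q by simp
  moreover have "(\<phi> \<longlongrightarrow> y) (filtermap p sequentially)"
    using assms(4) by (simp add: filterlim_filtermap)
  then have "(\<phi> \<longlongrightarrow> y) G" using G(3) by (rule tendsto_mono[rotated])
  ultimately show ?thesis by (rule tendsto_unique[OF G(1)])
qed

lemma interleaved_tendsto:
  assumes "(\<lambda>n. vertex (a n)) \<longlonglongrightarrow> vertex l"
    and "\<And>n. vertex (a n) \<le> y n" "\<And>n. y n < vertex (a (Suc n))"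
  shows "y \<longlonglongrightarrow> vertex l"
proof (rule tendsto_sandwich)
  show "(\<lambda>n. vertex (a n)) \<longlonglongrightarrow> vertex l" by (rule assms)
  show "(\<lambda>n. vertex (a (Suc n))) \<longlonglongrightarrow> vertex l"
    using assms(1) by (rule LIMSEQ_Suc)
  show "\<forall>\<^sub>F n in sequentially. vertex (a n) \<le> y n" using assms(2) by simp
  show "\<forall>\<^sub>F n in sequentially. y n \<le> vertex (a (Suc n))"
    using assms(3) by (simp add: less_imp_le)
qed

text \<open>
  The bound \<open>h\<close> of each chosen object is exceeded by the next ordinal of the sequence.
\<close>

lemma leapfrog_sequence:
  fixes P :: "nat \<Rightarrow> omega1 \<Rightarrow> 'x \<Rightarrow> bool" and h :: "'x \<Rightarrow> omega1"
  assumes "\<And>n a. \<exists>x. P n a x"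
  obtains a x where "strict_mono a" "\<xi> < a 0" "\<And>n. P n (a n) (x n)" "\<And>n. h (x n) < a (Suc n)"
proof -
  have "\<exists>s. \<forall>n. (P n (fst (s n)) (snd (s n)) \<and> \<xi> < fst (s n)) \<and>
      (fst (s n) < fst (s (Suc n)) \<and> h (snd (s n)) < fst (s (Suc n)))"
  proof (rule dependent_nat_choice)
    obtain b where "\<xi> < b" using omega1_gt_ex by blast
    moreover obtain x where "P 0 b x" using assms by blast
    ultimately show "\<exists>s. P 0 (fst s) (snd s) \<and> \<xi> < fst s"
      by (intro exI[of _ "(b, x)"]) simp
  next
    fix s :: "omega1 \<times> 'x" and n
    assume s: "P n (fst s) (snd s) \<and> \<xi> < fst s"
    obtain b where b: "max (fst s) (h (snd s)) < b" using omega1_gt_ex by blast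
    moreover obtain x where "P (Suc n) b x" using assms by blast
    ultimately show "\<exists>t. (P (Suc n) (fst t) (snd t) \<and> \<xi> < fst t) \<and>
        fst s < fst t \<and> h (snd s) < fst t"
      using s by (intro exI[of _ "(b, x)"]) auto
  qed
  then obtain s where s: "\<And>n. P n (fst (s n)) (snd (s n))" "\<And>n. \<xi> < fst (s n)"
    "\<And>n. fst (s n) < fst (s (Suc n))" "\<And>n. h (snd (s n)) < fst (s (Suc n))"
    by blast
  show ?thesis
    by (rule that[of "\<lambda>n. fst (s n)" "\<lambda>n. snd (s n)"]) (use s in \<open>auto intro: strict_mono_Suc_iff[THEN iffD2]\<close>)
qed

text \<open>
  Two sequences are chosen alternately above an increasing sequence of ordinals. Their
  positions are squeezed by these ordinals and converge to the same limit \<open>vertex l\<close>, and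
  compactness of \<open>up_to l\<close> gives a cluster point of each. The function \<open>h\<close> makes further
  unbounded quantities of the first sequence take part in the squeeze.
\<close>

lemma leapfrog:
  fixes P Q :: "nat \<Rightarrow> omega1 \<Rightarrow> point \<Rightarrow> bool" and h :: "point \<Rightarrow> omega1"
  assumes P: "\<And>n a. \<exists>p\<in>layers. vertex a \<le> pos p \<and> P n a p"
    and Q: "\<And>n a. \<exists>p\<in>layers. vertex a \<le> pos p \<and> Q n a p"
  obtains a l p q p' q' where "\<xi> < a 0" "\<And>n. a n < l" "(\<lambda>n. vertex (a n)) \<longlonglongrightarrow> vertex l"
    and "\<And>n. p n \<in> layers" "\<And>n. P n (a n) (p n)" "\<And>n. h (p n) < a (Suc n)"
      "\<And>n. pos (p n) < vertex (a (Suc n))" "clusters p q" "q \<in> layers" "pos q = vertex l"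
    and "\<And>n. p' n \<in> layers" "\<And>n. Q n (a n) (p' n)"
      "\<And>n. pos (p' n) < vertex (a (Suc n))" "clusters p' q'" "q' \<in> layers" "pos q' = vertex l"
proof -
  define H where "H = (\<lambda>x :: point \<times> point.
    max (h (fst x)) (max (block (pos (fst x))) (block (pos (snd x)))))"
  define R where "R n a x \<longleftrightarrow> (fst x \<in> layers \<and> vertex a \<le> pos (fst x) \<and> P n a (fst x)) \<and>
    (snd x \<in> layers \<and> vertex a \<le> pos (snd x) \<and> Q n a (snd x))" for n a and x :: "point \<times> point"
  have R_ex: "\<exists>x. R n a x" for n a
  proof -
    obtain p where "p \<in> layers \<and> vertex a \<le> pos p \<and> P n a p" using P by blast
    moreover obtain p' where "p' \<in> layers \<and> vertex a \<le> pos p' \<and> Q n a p'" using Q by blast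
    ultimately have "R n a (p, p')" by (simp add: R_def)
    then show ?thesis by (rule exI)
  qed
  obtain a x where ax: "strict_mono a" "\<xi> < a 0" "\<And>n. R n (a n) (x n)" "\<And>n. H (x n) < a (Suc n)"
    by (rule leapfrog_sequence[of R \<xi> H, OF R_ex]) blast
  obtain l where l: "\<And>n. a n < l" "(\<lambda>n. vertex (a n)) \<longlonglongrightarrow> vertex l"
    by (rule omega1_sequence_limit[OF ax(1)]) blast
  have bd: "pos (fst (x n)) < vertex (a (Suc n))" "pos (snd (x n)) < vertex (a (Suc n))"
    "h (fst (x n)) < a (Suc n)" for n
    using ax(4)[of n] by (simp_all add: H_def less_vertex_iff)
  have lim: "\<exists>q\<in>layers. clusters p q \<and> pos q = vertex l"
    if p: "\<And>n. p n \<in> layers" "\<And>n. vertex (a n) \<le> pos (p n)" "\<And>n. pos (p n) < vertex (a (Suc n))" for p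
  proof -
    have "p n \<in> up_to l" for n
    proof -
      have "vertex (a (Suc n)) < vertex l" using l(1) by simp
      then have "pos (p n) \<le> vertex l" using p(3)[of n] by order
      then show ?thesis using p(1) by (simp add: up_to_def)
    qed
    then obtain q where q: "q \<in> up_to l" "clusters p q" using clusters_exists by blast
    moreover have "pos q = vertex l"
      using q(2) p(1) by (rule clusters_tendsto) (intro continuous_intros, rule interleaved_tendsto[OF l(2) p(2,3)])
    ultimately show ?thesis using up_to_subset by blast
  qed
  obtain q where q: "q \<in> layers" "clusters (\<lambda>n. fst (x n)) q" "pos q = vertex l"
    using lim[of "\<lambda>n. fst (x n)"] ax(3) bd(1) unfolding R_def by blast
  obtain q' where q': "q' \<in> layers" "clusters (\<lambda>n. snd (x n)) q'" "pos q' = vertex l"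
    using lim[of "\<lambda>n. snd (x n)"] ax(3) bd(2) unfolding R_def by blast
  show ?thesis
    by (rule that[OF ax(2) l, of "\<lambda>n. fst (x n)" q "\<lambda>n. snd (x n)" q'])
      (use ax(3) bd q q' in \<open>simp_all add: R_def\<close>)
qed

lemma leapfrog_single:
  fixes P :: "nat \<Rightarrow> omega1 \<Rightarrow> point \<Rightarrow> bool"
  assumes P: "\<And>n a. \<exists>p\<in>layers. vertex a \<le> pos p \<and> P n a p"
  obtains a l p q where "\<xi> < a 0" "\<And>n. a n < l" "(\<lambda>n. vertex (a n)) \<longlonglongrightarrow> vertex l"
    and "\<And>n. p n \<in> layers" "\<And>n. P n (a n) (p n)"
      "\<And>n. pos (p n) < vertex (a (Suc n))" "clusters p q" "q \<in> layers" "pos q = vertex l"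
  by (rule leapfrog[of P P \<xi> "\<lambda>_. \<xi>", OF P P]) (rule that)

lemma cofinal_leapfrog:
  assumes "cofinal C" "C \<subseteq> layers"
  shows "\<exists>p\<in>layers. vertex a \<le> pos p \<and> p \<in> C"
  using cofinalD[OF assms(1), of a] assms(2) by blast

section \<open>The level function is bounded on dominant sets\<close>

lemma continuous_bounded_up_to:
  fixes g :: "point \<Rightarrow> longray"
  assumes "continuous_on layers g"
  shows "\<exists>b. \<forall>p\<in>up_to a. g p < vertex b"
proof (cases "up_to a = {}")
  case False
  have "compact (g ` up_to a)"
    by (rule compact_continuous_image[OF continuous_on_subset[OF assms up_to_subset] compact_up_to])
  then obtain s where s: "\<forall>t\<in>g ` up_to a. t \<le> s"
    using compact_attains_sup[of "g ` up_to a"] False by blast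
  obtain b where "s < vertex b" using longray_less_vertex by blast
  then show ?thesis using s by (intro exI[of _ b]) (auto intro: le_less_trans)
qed simp

lemma eq_on_edge:
  assumes "p \<in> layers" "q \<in> layers" "pos p = vertex l" "lev p = vertex l" "pos q = vertex l" "lev q = vertex l"
  shows "p = q"
proof (rule layers_eqI)
  fix g assume "lev p = vertex g"
  then have "g = l" using assms(4) by simp
  then have "dep p g = vertex l" "dep q g = vertex l"
    using layersD(2,3)[OF assms(1), of l] layersD(2,3)[OF assms(2), of l] assms by (simp_all add: antisym)
  then show "dep p g = dep q g" by simp
qed (use assms in auto)

text \<open>
  The levels lie between the leapfrogging ordinals and the positions, so at the cluster points
  level and position agree. On that edge a point is determined by its position.
\<close>

lemma meet_on_edge:
  assumes C: "closed C" "C \<subseteq> layers" "\<And>a. \<exists>p\<in>C. vertex a \<le> lev p"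
    and D: "closed D" "D \<subseteq> layers" "\<And>a. \<exists>p\<in>D. vertex a \<le> lev p"
  shows "\<exists>q\<in>C \<inter> D. lev q = pos q \<and> vertex \<xi> \<le> pos q"
proof -
  have ex: "\<exists>p\<in>layers. vertex a \<le> pos p \<and> (p \<in> X \<and> vertex a \<le> lev p)"
    if X: "X \<subseteq> layers" "\<exists>p\<in>X. vertex a \<le> lev p" for a X
  proof -
    obtain p where "p \<in> X" "vertex a \<le> lev p" using X(2) by blast
    moreover have "p \<in> layers" using \<open>p \<in> X\<close> X(1) by blast
    moreover have "vertex a \<le> pos p" using layersD(1)[OF \<open>p \<in> layers\<close>] \<open>vertex a \<le> lev p\<close> by order
    ultimately show ?thesis by blast
  qed
  obtain a l p q p' q' where s: "\<xi> < a 0" "\<And>n. a n < l" "(\<lambda>n. vertex (a n)) \<longlonglongrightarrow> vertex l"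
    and p: "\<And>n. p n \<in> layers" "\<And>n. p n \<in> C \<and> vertex (a n) \<le> lev (p n)"
      "\<And>n. pos (p n) < vertex (a (Suc n))" "clusters p q" "q \<in> layers" "pos q = vertex l"
    and p': "\<And>n. p' n \<in> layers" "\<And>n. p' n \<in> D \<and> vertex (a n) \<le> lev (p' n)"
      "\<And>n. pos (p' n) < vertex (a (Suc n))" "clusters p' q'" "q' \<in> layers" "pos q' = vertex l"
    by (rule leapfrog[of "\<lambda>n a p. p \<in> C \<and> vertex a \<le> lev p" "\<lambda>n a p. p \<in> D \<and> vertex a \<le> lev p" \<xi> "\<lambda>_. \<xi>",
          OF ex[OF C(2,3)] ex[OF D(2,3)]]) blast
  have lev: "lev q = vertex l" if r: "\<And>n. r n \<in> layers" "\<And>n. vertex (a n) \<le> lev (r n)"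
    "\<And>n. pos (r n) < vertex (a (Suc n))" "clusters r q" for r q
    using r(4,1)
  proof (rule clusters_tendsto)
    show "continuous_on layers (\<lambda>p. lev p)" by (intro continuous_intros)
    show "(\<lambda>n. lev (r n)) \<longlonglongrightarrow> vertex l"
      using s(3) r(2)
    proof (rule interleaved_tendsto)
      show "lev (r n) < vertex (a (Suc n))" for n
        using layersD(1)[OF r(1)] r(3) by (rule le_less_trans)
    qed
  qed
  have "lev q = vertex l" "lev q' = vertex l"
    using lev[of p q] lev[of p' q'] p p' by simp_all
  then have "q = q'" using eq_on_edge p p' by simp
  moreover have "q \<in> C" using p(4) C(1) by (rule clusters_closed) (use p(2) in simp)
  moreover have "q' \<in> D" using p'(4) D(1) by (rule clusters_closed) (use p'(2) in simp)
  moreover have "\<xi> < l" using s(1) s(2)[of 0] by order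
  ultimately show ?thesis using \<open>lev q = vertex l\<close> p(6) by (intro bexI[of _ q]) auto
qed

text \<open>
  If the level were unbounded on \<open>D\<close>, it would be bounded on the complement of \<open>U\<close>,
  because closed sets with unbounded level meet. So \<open>U\<close> contains the edge \<open>C\<close> on which
  the depth of some \<open>g\<close> equals the position, while that depth is constantly \<open>vertex g\<close> on the
  club \<open>D'\<close> of points of \<open>D\<close> with level equal to position.
\<close>

lemma lev_bounded_if_dominant:
  assumes "locally_dominant layered below D"
  shows "bounded_on lev D"
proof (rule ccontr)
  assume "\<not> bounded_on lev D"
  then have levD: "\<exists>p\<in>D. vertex a \<le> lev p" for a
    by (auto simp: longray_bounded_iff not_less)
  have D: "D \<subseteq> layers" "closed D"
    using assms by (simp_all add: locally_dominant_def club_layered)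
  have "\<exists>U. openin layered U \<and> D \<subseteq> U \<and>
      (\<forall>f C D'. continuous_on layers f \<and> club layered below C \<and> C \<subseteq> U \<and>
        club layered below D' \<and> D' \<subseteq> D \<and> bounded_on f D' \<longrightarrow> bounded_on f C)"
    using assms unfolding locally_dominant_def continuous_map_layered by (rule conjunct2)
  then obtain U where U: "openin layered U" "D \<subseteq> U"
    and dom: "\<forall>f C D'. continuous_on layers f \<and> club layered below C \<and> C \<subseteq> U \<and>
      club layered below D' \<and> D' \<subseteq> D \<and> bounded_on f D' \<longrightarrow> bounded_on f C"
    by (elim exE conjE)
  define K where "K = layers - U"
  have K: "closed K" "K \<subseteq> layers"
    using U(1) closedin_diff[OF closedin_topspace U(1)] closedin_closed_eq[OF closed_layers]
    by (auto simp: K_def)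
  have "\<not> (\<forall>a. \<exists>p\<in>K. vertex a \<le> lev p)"
  proof
    assume "\<forall>a. \<exists>p\<in>K. vertex a \<le> lev p"
    then obtain q where "q \<in> D \<inter> K" using meet_on_edge[OF D(2,1) levD K] by blast
    then show False using U(2) by (auto simp: K_def)
  qed
  then obtain g where g: "\<And>p. p \<in> K \<Longrightarrow> lev p < vertex g" by (auto simp: not_le)
  have cont: "continuous_on layers (\<lambda>p. dep p g)" by (intro continuous_intros)
  define D' where "D' = D \<inter> {p. lev p = pos p}"
  have "club layered below D'"
    unfolding club_layered
  proof (intro conjI)
    show "D' \<subseteq> layers" using D(1) by (auto simp: D'_def)
    show "closed D'" unfolding D'_def
      by (intro closed_Int D(2) closed_Collect_eq continuous_intros)
    show "cofinal D'"
      unfolding cofinal_def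
    proof
      fix a
      obtain q where "q \<in> D \<inter> D" "lev q = pos q" "vertex a \<le> pos q"
        using meet_on_edge[OF D(2,1) levD D(2,1) levD] by blast
      then show "\<exists>p\<in>D'. vertex a \<le> pos p" by (auto simp: D'_def)
    qed
  qed
  moreover have "bounded_on (\<lambda>p. dep p g) D'"
  proof -
    obtain b where "g < b" using omega1_gt_ex by blast
    have "dep p g = vertex g" if "p \<in> D'" for p
    proof -
      have p: "p \<in> layers" "lev p = pos p" using that D(1) by (auto simp: D'_def)
      show ?thesis
      proof (cases "vertex g < lev p")
        case True then show ?thesis by (rule layersD(4)[OF p(1)])
      next
        case False
        then show ?thesis
          using layersD(2,3)[OF p(1), of g] p(2) by (simp add: max_absorb2 not_less antisym)
      qed
    qed
    then show ?thesis using \<open>g < b\<close> by (auto simp: longray_bounded_iff)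
  qed
  moreover define C where "C = {p \<in> layers. lev p = vertex g \<and> dep p g = pos p}"
  have C_pt: "layer_point (vertex b) (vertex g) (vertex b) \<in> C" if "g \<le> b" for b
    using that by (auto simp: C_def intro!: layer_point_in_layers)
  have "club layered below C"
    unfolding club_layered
  proof (intro conjI)
    have "C = {p \<in> layers. lev p = vertex g} \<inter> {p \<in> layers. dep p g = pos p}" by (auto simp: C_def)
    moreover have "closed {p \<in> layers. lev p = vertex g}" "closed {p \<in> layers. dep p g = pos p}"
      by (intro closed_layers_eq continuous_intros)+
    ultimately show "closed C" by (simp only: closed_Int)
    show "cofinal C"
      unfolding cofinal_def
    proof
      fix a
      have "layer_point (vertex (max a g)) (vertex g) (vertex (max a g)) \<in> C" by (rule C_pt) simp
      then show "\<exists>p\<in>C. vertex a \<le> pos p" by (rule bexI[rotated]) simp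
    qed
  qed (auto simp: C_def)
  moreover have "C \<subseteq> U" using g by (force simp: C_def K_def)
  ultimately have "bounded_on (\<lambda>p. dep p g) C" using dom[rule_format, of "\<lambda>p. dep p g" C D'] cont by (simp add: D'_def)
  then obtain b where b: "\<And>p. p \<in> C \<Longrightarrow> dep p g < vertex b" by (auto simp: longray_bounded_iff)
  have "vertex (max g b) < vertex b"
    using b[OF C_pt[of "max g b"]] by simp
  then show False by simp
qed

section \<open>Lines inside strips are locally dominant\<close>

lemma tendsto_if_dist_inverse:
  fixes x :: "nat \<Rightarrow> real"
  assumes "\<And>n. \<bar>x n - y\<bar> < 1 / real (Suc n)"
  shows "x \<longlonglongrightarrow> y"
proof -
  have "(\<lambda>n. x n - y) \<longlonglongrightarrow> 0"
  proof (rule Lim_null_comparison)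
    show "\<forall>\<^sub>F n in sequentially. norm (x n - y) \<le> 1 / real (Suc n)"
      using assms by (simp add: less_imp_le)
    show "(\<lambda>n. 1 / real (Suc n)) \<longlonglongrightarrow> 0"
      using LIMSEQ_inverse_real_of_nat by (simp add: inverse_eq_divide)
  qed
  then show ?thesis by (simp add: LIM_zero_iff)
qed

definition closed_strip :: "(point \<Rightarrow> real) \<Rightarrow> real \<Rightarrow> real \<Rightarrow> omega1 \<Rightarrow> point set"
  where "closed_strip c s t \<xi> = {p \<in> layers. vertex \<xi> \<le> pos p \<and> s \<le> c p \<and> c p \<le> t}"

text \<open>
  Let \<open>y\<close> be called good if \<open>g\<close> is bounded on a club inside the line \<open>c = y\<close>. Near a good
  \<open>y\<close> the function is uniformly bounded: otherwise points with large values leapfrog with the club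
  and cluster at the same point of the line, where \<open>g\<close> would be both bounded and
  arbitrarily large. Limits of good values are good, since countably many bounds have a common
  bound. Hence good values form an open and closed subset of the interval, and compactness makes
  the bound uniform; the bisection principle for real intervals combines these two steps.
\<close>

lemma strip_bounded:
  fixes c :: "point \<Rightarrow> real" and g :: "point \<Rightarrow> longray" and s t :: real and \<xi> :: omega1
  defines "N \<equiv> closed_strip c s t \<xi>"
  assumes c: "continuous_on layers c"
    and inj: "\<And>p q. p \<in> N \<Longrightarrow> q \<in> N \<Longrightarrow> pos p = pos q \<Longrightarrow> c p = c q \<Longrightarrow> p = q"
    and lines: "\<And>y a. s \<le> y \<Longrightarrow> y \<le> t \<Longrightarrow> \<exists>p\<in>layers. c p = y \<and> vertex a \<le> pos p"
    and g: "continuous_on layers g"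
    and D: "D \<subseteq> N" "closed D" "cofinal D" "\<And>p. p \<in> D \<Longrightarrow> c p = y0" "\<And>p. p \<in> D \<Longrightarrow> g p < vertex b0"
  shows "\<exists>b. \<forall>p\<in>N. g p < vertex b"
proof -
  have N_sub: "N \<subseteq> layers" by (auto simp: N_def closed_strip_def)
  have closed_N: "closed N"
  proof -
    have "N = ({p \<in> layers. vertex \<xi> \<le> pos p} \<inter> {p \<in> layers. s \<le> c p}) \<inter> {p \<in> layers. c p \<le> t}"
      by (auto simp: N_def closed_strip_def)
    moreover have "closed {p \<in> layers. vertex \<xi> \<le> pos p}" "closed {p \<in> layers. s \<le> c p}"
      "closed {p \<in> layers. c p \<le> t}"
      by (intro closed_layers_le c continuous_intros)+
    ultimately show ?thesis by (simp only: closed_Int)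
  qed
  define Bd where "Bd y \<longleftrightarrow> (\<exists>D b. D \<subseteq> N \<and> closed D \<and> cofinal D \<and> (\<forall>p\<in>D. c p = y \<and> g p < vertex b))" for y
  have spread: "\<exists>d>0. \<exists>b. \<forall>p\<in>N. \<bar>c p - y\<bar> < d \<longrightarrow> g p < vertex b" if "Bd y" for y
  proof (rule ccontr)
    assume contra: "\<not> ?thesis"
    obtain E b where E: "E \<subseteq> N" "closed E" "cofinal E" "\<And>p. p \<in> E \<Longrightarrow> c p = y" "\<And>p. p \<in> E \<Longrightarrow> g p < vertex b"
      using \<open>Bd y\<close> unfolding Bd_def by blast
    \<comment> \<open>On \<open>up_to a\<close> the function is bounded by \<open>b'\<close>, so a value of at least \<open>b'\<close> forces the position
      beyond \<open>a\<close>.\<close>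
    have unb: "\<exists>p\<in>layers. vertex a \<le> pos p \<and> (p \<in> N \<and> \<bar>c p - y\<bar> < 1 / real (Suc n) \<and> vertex a \<le> g p)" for n a
    proof -
      obtain b' where b': "\<forall>p\<in>up_to a. g p < vertex b'" using continuous_bounded_up_to[OF g] by blast
      have "\<not> (\<forall>p\<in>N. \<bar>c p - y\<bar> < 1 / real (Suc n) \<longrightarrow> g p < vertex (max a b'))"
        using contra by (metis of_nat_0_less_iff zero_less_Suc zero_less_divide_1_iff)
      then obtain p where p: "p \<in> N" "\<bar>c p - y\<bar> < 1 / real (Suc n)" "vertex (max a b') \<le> g p"
        by (auto simp: not_less)
      have ab: "vertex a \<le> vertex (max a b')" "vertex b' \<le> vertex (max a b')" by simp_all
      have "p \<in> layers" using p(1) N_sub by blast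
      moreover have "p \<notin> up_to a"
      proof
        assume "p \<in> up_to a"
        then have "g p < vertex b'" using b' by blast
        then show False using p(3) ab(2) by order
      qed
      moreover have "vertex a \<le> g p" using p(3) ab(1) by order
      ultimately show ?thesis using p by (intro bexI[of _ p]) (auto simp: up_to_def)
    qed
    have E': "\<exists>p\<in>layers. vertex a \<le> pos p \<and> p \<in> E" for a
      by (rule cofinal_leapfrog) (use E N_sub in auto)
    obtain a l p q p' q' where s: "b < a 0" "\<And>n. a n < l" "(\<lambda>n. vertex (a n)) \<longlonglongrightarrow> vertex l"
      and p: "\<And>n. p n \<in> layers"
        "\<And>n. p n \<in> N \<and> \<bar>c (p n) - y\<bar> < 1 / real (Suc n) \<and> vertex (a n) \<le> g (p n)"
        "\<And>n. block (g (p n)) < a (Suc n)" "\<And>n. pos (p n) < vertex (a (Suc n))"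
        "clusters p q" "q \<in> layers" "pos q = vertex l"
      and p': "\<And>n. p' n \<in> layers" "\<And>n. p' n \<in> E"
        "\<And>n. pos (p' n) < vertex (a (Suc n))" "clusters p' q'" "q' \<in> layers" "pos q' = vertex l"
      by (rule leapfrog[of "\<lambda>n a p. p \<in> N \<and> \<bar>c p - y\<bar> < 1 / real (Suc n) \<and> vertex a \<le> g p"
            "\<lambda>n a p. p \<in> E" b "\<lambda>p. block (g p)", OF unb E']) blast
    have "q \<in> N" using p(5) closed_N by (rule clusters_closed) (use p(2) in simp)
    have "c q = y"
      using p(5,1) c by (rule clusters_tendsto) (rule tendsto_if_dist_inverse, use p(2) in simp)
    have gq: "g q = vertex l"
      using p(5,1) g
    proof (rule clusters_tendsto)
      show "(\<lambda>n. g (p n)) \<longlonglongrightarrow> vertex l"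
        using s(3)
      proof (rule interleaved_tendsto)
        show "vertex (a n) \<le> g (p n)" for n using p(2) by simp
        show "g (p n) < vertex (a (Suc n))" for n using p(3) by (simp add: less_vertex_iff)
      qed
    qed
    have "q' \<in> E" using p'(4) E(2) by (rule clusters_closed) (use p'(2) in simp)
    have "q = q'"
      using inj[of q q'] \<open>q \<in> N\<close> \<open>q' \<in> E\<close> E(1,4) \<open>c q = y\<close> p(7) p'(6) by auto
    then have "g q < vertex b" using E(5) \<open>q' \<in> E\<close> by blast
    then have "l < b" using gq by simp
    then show False using s(1) s(2)[of 0] by order
  qed
  have unspread: "\<exists>d>0. \<forall>y'. s \<le> y' \<and> y' \<le> t \<and> \<bar>y' - y\<bar> < d \<longrightarrow> \<not> Bd y'"
    if "\<not> Bd y" "s \<le> y" "y \<le> t" for y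
  proof (rule ccontr)
    assume contra: "\<not> ?thesis"
    have "\<exists>y'. \<bar>y' - y\<bar> < 1 / real (Suc n) \<and> Bd y'" for n
    proof -
      have "0 < 1 / real (Suc n)" by simp
      then show ?thesis using contra by blast
    qed
    then obtain ys where ys: "\<And>n. \<bar>ys n - y\<bar> < 1 / real (Suc n)" "\<And>n. Bd (ys n)" by metis
    have "\<exists>E b. E \<subseteq> N \<and> closed E \<and> cofinal E \<and> (\<forall>p\<in>E. c p = ys n \<and> g p < vertex b)" for n
      using ys(2) unfolding Bd_def by blast
    then obtain E b where E: "\<And>n. E n \<subseteq> N" "\<And>n. cofinal (E n)"
      "\<And>n p. p \<in> E n \<Longrightarrow> c p = ys n \<and> g p < vertex (b n)" by metis
    obtain \<beta> where "\<forall>a\<in>range b. a < \<beta>" using countable_omega1_bounded[of "range b"] by auto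
    then have \<beta>: "b n < \<beta>" for n by simp
    define F where "F = (N \<inter> {p \<in> layers. c p = y}) \<inter> {p \<in> layers. g p \<le> vertex \<beta>}"
    have "closed F" unfolding F_def
      by (intro closed_Int closed_N closed_layers_eq closed_layers_le c g continuous_intros)
    moreover have "cofinal F"
      unfolding cofinal_def
    proof
      fix \<eta>
      have E': "\<exists>p\<in>layers. vertex a \<le> pos p \<and> p \<in> E n" for n a
        using cofinal_leapfrog[OF E(2)] E(1) N_sub by blast
      obtain a l p q where s: "\<eta> < a 0" "\<And>n. a n < l"
        and p: "\<And>n. p n \<in> layers" "\<And>n. p n \<in> E n" "clusters p q" "q \<in> layers" "pos q = vertex l"
        by (rule leapfrog_single[of "\<lambda>n a p. p \<in> E n" \<eta>, OF E']) (rule that)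
      have pN: "p n \<in> N" "c (p n) = ys n" "g (p n) < vertex (b n)" for n
        using p(2)[of n] E(1) E(3)[of "p n" n] by blast+
      have "q \<in> N" using p(3) closed_N by (rule clusters_closed) (rule pN)
      moreover have "c q = y"
        using p(3,1) c by (rule clusters_tendsto) (rule tendsto_if_dist_inverse, use ys(1) pN in simp)
      moreover have "q \<in> {p \<in> layers. g p \<le> vertex \<beta>}"
        using p(3)
      proof (rule clusters_closed)
        show "closed {p \<in> layers. g p \<le> vertex \<beta>}" by (intro closed_layers_le g continuous_intros)
        fix n
        have "vertex (b n) < vertex \<beta>" using \<beta> by simp
        then have "g (p n) \<le> vertex \<beta>" using pN(3)[of n] by order
        then show "p n \<in> {p \<in> layers. g p \<le> vertex \<beta>}" using p(1) by simp
      qed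
      ultimately have "q \<in> F" using p(4) by (simp add: F_def)
      moreover have "\<eta> < l" using s(1) s(2)[of 0] by order
      then have "vertex \<eta> \<le> pos q" using p(5) by simp
      ultimately show "\<exists>p\<in>F. vertex \<eta> \<le> pos p" by blast
    qed
    moreover obtain \<gamma> where "\<beta> < \<gamma>" using omega1_gt_ex by blast
    moreover have "c p = y \<and> g p < vertex \<gamma>" if "p \<in> F" for p
    proof -
      have "g p \<le> vertex \<beta>" "c p = y" using that by (simp_all add: F_def)
      moreover have "vertex \<beta> < vertex \<gamma>" using \<open>\<beta> < \<gamma>\<close> by simp
      ultimately show ?thesis by (meson le_less_trans)
    qed
    moreover have "F \<subseteq> N" by (simp add: F_def) blast
    ultimately have "Bd y" unfolding Bd_def by blast
    then show False using that(1) by contradiction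
  qed
  have Bd_line: "Bd y" if y: "s \<le> y" "y \<le> t" and b: "\<And>p. p \<in> N \<Longrightarrow> c p = y \<Longrightarrow> g p < vertex b" for y b
  proof -
    define F where "F = N \<inter> {p \<in> layers. c p = y}"
    have "closed F" unfolding F_def by (intro closed_Int closed_N closed_layers_eq c continuous_intros)
    moreover have "cofinal F"
      unfolding cofinal_def
    proof
      fix a
      obtain p where p: "p \<in> layers" "c p = y" "vertex (max a \<xi>) \<le> pos p" using lines[OF y] by blast
      have "vertex a \<le> vertex (max a \<xi>)" "vertex \<xi> \<le> vertex (max a \<xi>)" by simp_all
      then have "vertex a \<le> pos p" "vertex \<xi> \<le> pos p" using p(3) by order+
      then show "\<exists>p\<in>F. vertex a \<le> pos p"
        using p y by (intro bexI[of _ p]) (simp_all add: F_def N_def closed_strip_def)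
    qed
    moreover have "\<forall>p\<in>F. c p = y \<and> g p < vertex b" using b by (simp add: F_def)
    moreover have "F \<subseteq> N" by (simp add: F_def)
    ultimately show ?thesis unfolding Bd_def by blast
  qed
  obtain p0 where "p0 \<in> D" using cofinalD[OF D(3)] by blast
  then have y0: "s \<le> y0" "y0 \<le> t" using D(1) D(4)[of p0] by (auto simp: N_def closed_strip_def)
  \<comment> \<open>One good value in the interval from \<open>u\<close> to \<open>v\<close> makes \<open>g\<close> bounded over all of it. Values outside
    the range from \<open>s\<close> to \<open>t\<close> have to be admitted because the bisection principle quantifies over
    arbitrary intervals.\<close>
  define P where "P u v \<longleftrightarrow> (\<exists>y. u \<le> y \<and> y \<le> v \<and> s \<le> y \<and> y \<le> t \<and> Bd y) \<longrightarrow>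
    (\<exists>b. \<forall>p\<in>N. u \<le> c p \<and> c p \<le> v \<longrightarrow> g p < vertex b)" for u v
  have "s \<le> t" using y0 by simp
  then have "P s t"
  proof (induction rule: Bolzano)
    case (trans u v w)
    show ?case unfolding P_def
    proof
      assume "\<exists>y. u \<le> y \<and> y \<le> w \<and> s \<le> y \<and> y \<le> t \<and> Bd y"
      then obtain y where y: "u \<le> y" "y \<le> w" "s \<le> y" "y \<le> t" "Bd y" by blast
      have left: "\<exists>b. \<forall>p\<in>N. u \<le> c p \<and> c p \<le> v \<longrightarrow> g p < vertex b"
        if "\<exists>y. u \<le> y \<and> y \<le> v \<and> s \<le> y \<and> y \<le> t \<and> Bd y"
        using trans(1) that unfolding P_def by blast
      have right: "\<exists>b. \<forall>p\<in>N. v \<le> c p \<and> c p \<le> w \<longrightarrow> g p < vertex b"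
        if "\<exists>y. v \<le> y \<and> y \<le> w \<and> s \<le> y \<and> y \<le> t \<and> Bd y"
        using trans(2) that unfolding P_def by blast
      have both: "(\<exists>b. \<forall>p\<in>N. u \<le> c p \<and> c p \<le> v \<longrightarrow> g p < vertex b) \<and>
          (\<exists>b. \<forall>p\<in>N. v \<le> c p \<and> c p \<le> w \<longrightarrow> g p < vertex b)"
      proof (cases "y \<le> v")
        case True
        then obtain b where b: "\<forall>p\<in>N. u \<le> c p \<and> c p \<le> v \<longrightarrow> g p < vertex b" using left y by blast
        have "\<exists>b. \<forall>p\<in>N. v \<le> c p \<and> c p \<le> w \<longrightarrow> g p < vertex b"
        proof (cases "v \<le> t")
          case True
          have "s \<le> v" using y(3) \<open>y \<le> v\<close> by simp
          then have "Bd v" using True b \<open>u \<le> v\<close> by (intro Bd_line[of v b]) auto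
          then show ?thesis using right True \<open>s \<le> v\<close> \<open>v \<le> w\<close> by blast
        next
          case False
          then have "\<forall>p\<in>N. v \<le> c p \<and> c p \<le> w \<longrightarrow> g p < vertex \<xi>" by (auto simp: N_def closed_strip_def)
          then show ?thesis by blast
        qed
        then show ?thesis using b by blast
      next
        case False
        then have "\<exists>b. \<forall>p\<in>N. v \<le> c p \<and> c p \<le> w \<longrightarrow> g p < vertex b" using right y by force
        then obtain b where b: "\<forall>p\<in>N. v \<le> c p \<and> c p \<le> w \<longrightarrow> g p < vertex b" by blast
        have "\<exists>b. \<forall>p\<in>N. u \<le> c p \<and> c p \<le> v \<longrightarrow> g p < vertex b"
        proof (cases "s \<le> v")
          case True
          have "v \<le> t" using y(4) False by simp
          then have "Bd v" using True b \<open>v \<le> w\<close> by (intro Bd_line[of v b]) auto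
          then show ?thesis using left True \<open>v \<le> t\<close> \<open>u \<le> v\<close> by blast
        next
          case False
          then have "\<forall>p\<in>N. u \<le> c p \<and> c p \<le> v \<longrightarrow> g p < vertex \<xi>" by (auto simp: N_def closed_strip_def)
          then show ?thesis by blast
        qed
        then show ?thesis using b by blast
      qed
      then obtain b b' where bb: "\<forall>p\<in>N. u \<le> c p \<and> c p \<le> v \<longrightarrow> g p < vertex b"
        "\<forall>p\<in>N. v \<le> c p \<and> c p \<le> w \<longrightarrow> g p < vertex b'" by blast
      have "g p < vertex (max b b')" if p: "p \<in> N" "u \<le> c p \<and> c p \<le> w" for p
      proof -
        have "vertex b \<le> vertex (max b b')" "vertex b' \<le> vertex (max b b')" by simp_all
        moreover have "g p < vertex b \<or> g p < vertex b'" using bb p linear[of "c p" v] by blast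
        ultimately show ?thesis by (auto intro: less_le_trans)
      qed
      then show "\<exists>b. \<forall>p\<in>N. u \<le> c p \<and> c p \<le> w \<longrightarrow> g p < vertex b" by blast
    qed
  next
    case (local y)
    show ?case
    proof (cases "Bd y")
      case True
      then obtain d b where d: "d > 0" "\<forall>p\<in>N. \<bar>c p - y\<bar> < d \<longrightarrow> g p < vertex b"
        using spread by blast
      have "P u v" if "u \<le> y \<and> y \<le> v \<and> v - u < d" for u v
      proof -
        have "\<forall>p\<in>N. u \<le> c p \<and> c p \<le> v \<longrightarrow> g p < vertex b"
        proof (intro ballI impI)
          fix p assume "p \<in> N" "u \<le> c p \<and> c p \<le> v"
          moreover from this that have "\<bar>c p - y\<bar> < d" by linarith
          ultimately show "g p < vertex b" using d(2) by blast
        qed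
        then show ?thesis unfolding P_def by blast
      qed
      then show ?thesis using d(1) by blast
    next
      case False
      then obtain d where d: "d > 0" "\<And>y'. s \<le> y' \<and> y' \<le> t \<and> \<bar>y' - y\<bar> < d \<Longrightarrow> \<not> Bd y'"
        using unspread local by blast
      have "P u v" if "u \<le> y \<and> y \<le> v \<and> v - u < d" for u v
      proof -
        have "\<not> Bd y'" if "u \<le> y' \<and> y' \<le> v \<and> s \<le> y' \<and> y' \<le> t" for y'
        proof (rule d(2))
          have "\<bar>y' - y\<bar> < d" using that \<open>u \<le> y \<and> y \<le> v \<and> v - u < d\<close> by linarith
          then show "s \<le> y' \<and> y' \<le> t \<and> \<bar>y' - y\<bar> < d" using that by simp
        qed
        then show ?thesis unfolding P_def by blast
      qed
      then show ?thesis using d(1) by blast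
    qed
  qed
  moreover have "Bd y0" unfolding Bd_def using D by blast
  ultimately obtain b where "\<forall>p\<in>N. s \<le> c p \<and> c p \<le> t \<longrightarrow> g p < vertex b"
    unfolding P_def using y0 by blast
  then have "\<forall>p\<in>N. g p < vertex b" by (simp add: N_def closed_strip_def)
  then show ?thesis by (rule exI)
qed

lemma scale_le_iff:
  assumes "x \<le> vertex b \<or> y \<le> vertex b"
  shows "scale b x \<le> scale b y \<longleftrightarrow> x \<le> y"
proof
  show "scale b x \<le> scale b y" if "x \<le> y" using that by (rule scale_mono)
  show "x \<le> y" if "scale b x \<le> scale b y"
  proof (rule ccontr)
    assume "\<not> x \<le> y"
    then have "y < x" by simp
    moreover have "y \<le> vertex b" using assms \<open>y < x\<close> by (auto intro: order_trans)
    ultimately have "scale b y < scale b x" by (rule scale_strict_mono)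
    then show False using that by simp
  qed
qed

text \<open>
  The open strip around the line serves as the neighbourhood. A club in it lies in the closed
  strip up to a part inside the compact set \<open>up_to b\<close>. Since \<open>v2 \<le> vertex b\<close>, the scale of \<open>b\<close> turns
  the coordinate into a real-valued one without changing the strip.
\<close>

lemma line_locally_dominant:
  fixes \<phi> :: "point \<Rightarrow> longray"
  assumes \<phi>: "continuous_on layers \<phi>"
    and v: "v1 < v0" "v0 < v2" "v2 \<le> vertex b" and "b \<le> \<xi>"
    and inj: "\<And>p q. p \<in> layers \<Longrightarrow> q \<in> layers \<Longrightarrow> vertex b \<le> pos p \<Longrightarrow> v1 \<le> \<phi> p \<Longrightarrow> \<phi> p \<le> v2 \<Longrightarrow>
      pos q = pos p \<Longrightarrow> \<phi> q = \<phi> p \<Longrightarrow> p = q"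
    and lines: "\<And>v a. v1 \<le> v \<Longrightarrow> v \<le> v2 \<Longrightarrow> \<exists>p\<in>layers. \<phi> p = v \<and> vertex a \<le> pos p"
  shows "locally_dominant layered below {p \<in> layers. \<phi> p = v0 \<and> vertex \<xi> \<le> pos p}"
    (is "locally_dominant _ _ ?D")
proof -
  define c where "c = (\<lambda>p. scale b (\<phi> p))"
  define N where "N = closed_strip c (scale b v1) (scale b v2) b"
  have v12: "v1 \<le> vertex b" "v0 \<le> vertex b" "v1 \<le> v2" using v by order+
  have c_iff: "scale b v1 \<le> c p \<and> c p \<le> scale b v2 \<longleftrightarrow> v1 \<le> \<phi> p \<and> \<phi> p \<le> v2" for p
    using v12 v(3) by (simp add: c_def scale_le_iff)
  have N_iff: "p \<in> N \<longleftrightarrow> p \<in> layers \<and> vertex b \<le> pos p \<and> v1 \<le> \<phi> p \<and> \<phi> p \<le> v2" for p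
    unfolding N_def closed_strip_def using c_iff by simp
  have c_cont: "continuous_on layers c"
    unfolding c_def by (intro continuous_intros \<phi>)
  have N_inj: "p = q" if "p \<in> N" "q \<in> N" "pos p = pos q" "c p = c q" for p q
  proof -
    have "\<phi> p \<le> vertex b" "\<phi> q \<le> vertex b" using that v(3) by (auto simp: N_iff intro: order_trans)
    then have "\<phi> p = \<phi> q" using that(4) scale_inj unfolding c_def by blast
    then show ?thesis using that(1-3) by (intro inj) (auto simp: N_iff)
  qed
  have N_lines: "\<exists>p\<in>layers. c p = y \<and> vertex a \<le> pos p" if y: "scale b v1 \<le> y" "y \<le> scale b v2" for y a
  proof -
    obtain w where w: "v1 \<le> w" "w \<le> v2" "scale b w = y"
      using IVT'[OF y v12(3) continuous_on_scale] by blast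
    obtain p where "p \<in> layers" "\<phi> p = w" "vertex a \<le> pos p" using lines[OF w(1,2)] by blast
    then show ?thesis using w(3) by (auto simp: c_def)
  qed
  have D_club: "club layered below ?D"
    unfolding club_layered
  proof (intro conjI)
    have "?D = {p \<in> layers. \<phi> p = v0} \<inter> {p \<in> layers. vertex \<xi> \<le> pos p}" by auto
    moreover have "closed {p \<in> layers. \<phi> p = v0}" "closed {p \<in> layers. vertex \<xi> \<le> pos p}"
      by (intro closed_layers_eq closed_layers_le \<phi> continuous_intros)+
    ultimately show "closed ?D" by (simp only: closed_Int)
    show "cofinal ?D"
      unfolding cofinal_def
    proof
      fix a
      obtain p where p: "p \<in> layers" "\<phi> p = v0" "vertex (max a \<xi>) \<le> pos p"
        using lines[of v0 "max a \<xi>", OF less_imp_le[OF v(1)] less_imp_le[OF v(2)]] by blast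
      have "vertex a \<le> vertex (max a \<xi>)" "vertex \<xi> \<le> vertex (max a \<xi>)" by simp_all
      then have "vertex a \<le> pos p" "vertex \<xi> \<le> pos p" using p(3) by order+
      then show "\<exists>p\<in>?D. vertex a \<le> pos p" using p by blast
    qed
  qed auto
  define U where "U = {p \<in> layers. v1 < \<phi> p \<and> \<phi> p < v2}"
  have "openin layered U"
  proof -
    have cl: "closed ({p \<in> layers. \<phi> p \<le> v1} \<union> {p \<in> layers. v2 \<le> \<phi> p})"
      by (intro closed_Un closed_layers_le \<phi> continuous_intros)
    moreover have "U = layers \<inter> - ({p \<in> layers. \<phi> p \<le> v1} \<union> {p \<in> layers. v2 \<le> \<phi> p})"
      by (auto simp: U_def)
    ultimately show ?thesis using openin_open_Int[OF open_Compl[OF cl], of layers] by (simp only:)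
  qed
  moreover have "?D \<subseteq> U" using v by (auto simp: U_def)
  moreover have "bounded_on g C"
    if g: "continuous_on layers g" and C: "C \<subseteq> U" and D': "club layered below D'" "D' \<subseteq> ?D" "bounded_on g D'"
    for g C D'
  proof -
    obtain b0 where b0: "\<And>p. p \<in> D' \<Longrightarrow> g p < vertex b0" using D'(3) by (auto simp: longray_bounded_iff)
    have "D' \<subseteq> N"
    proof
      fix p assume "p \<in> D'"
      then have p: "p \<in> layers" "\<phi> p = v0" "vertex \<xi> \<le> pos p" using D'(2) by auto
      moreover have "vertex b \<le> vertex \<xi>" using \<open>b \<le> \<xi>\<close> by simp
      then have "vertex b \<le> pos p" using p(3) by order
      ultimately show "p \<in> N" using v by (simp add: N_iff less_imp_le)
    qed
    moreover have "c p = scale b v0" if "p \<in> D'" for p using that D'(2) by (auto simp: c_def)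
    ultimately have "\<exists>b1. \<forall>p\<in>N. g p < vertex b1"
      using D'(1) b0 unfolding club_layered N_def
      by (intro strip_bounded[OF c_cont N_inj[unfolded N_def] N_lines g]) auto
    then obtain b1 where b1: "\<forall>p\<in>N. g p < vertex b1" ..
    obtain b2 where b2: "\<forall>p\<in>up_to b. g p < vertex b2" using continuous_bounded_up_to[OF g] by blast
    have "g p < vertex (max b1 b2)" if "p \<in> C" for p
    proof -
      have "p \<in> layers" "v1 \<le> \<phi> p" "\<phi> p \<le> v2" using that C by (auto simp: U_def less_imp_le)
      then have "p \<in> N \<or> p \<in> up_to b"
        using linear[of "vertex b" "pos p"] by (auto simp: N_iff up_to_def)
      then have "g p < vertex b1 \<or> g p < vertex b2" using b1 b2 by blast
      moreover have "vertex b1 \<le> vertex (max b1 b2)" "vertex b2 \<le> vertex (max b1 b2)" by simp_all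
      ultimately show ?thesis by (meson less_le_trans)
    qed
    then show ?thesis unfolding longray_bounded_iff by blast
  qed
  ultimately show ?thesis
    unfolding locally_dominant_def continuous_map_layered using D_club
    by (intro conjI exI[of _ U]) blast+
qed

text \<open>
  A positive offset leaves room for a strip of levels that contains no ordinal, where position and
  level determine a point.
\<close>

lemma level_line_dominant:
  assumes "0 < offset v0"
  shows "\<exists>b. \<forall>\<xi>\<ge>b. locally_dominant layered below {p \<in> layers. lev p = v0 \<and> vertex \<xi> \<le> pos p}"
proof -
  define g where "g = block v0"
  have "vertex g < v0" using assms by (simp add: less_longray_iff g_def)
  then obtain v1 where v1: "vertex g < v1" "v1 < v0" using dense by blast
  define v2 where "v2 = Abs_longray (g, (offset v0 + 1) / 2)"
  have bv2: "block v2 = g" "offset v2 = (offset v0 + 1) / 2"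
    using assms offset_bounds[of v0] by (simp_all add: v2_def)
  then have v2: "v0 < v2" using offset_bounds[of v0] by (simp add: less_longray_iff g_def)
  obtain b where "g < b" using omega1_gt_ex by blast
  then have v2b: "v2 < vertex b" using bv2 by (simp add: less_vertex_iff)
  have no_vertex: "v \<noteq> vertex h" if "v1 \<le> v" "v \<le> v2" for v h
  proof
    assume h: "v = vertex h"
    then have "vertex g < vertex h" using that(1) v1(1) by order
    moreover have "h \<le> g" using block_mono[OF that(2)] h bv2 by simp
    ultimately show False by simp
  qed
  have "locally_dominant layered below {p \<in> layers. lev p = v0 \<and> vertex \<xi> \<le> pos p}" if "b \<le> \<xi>" for \<xi>
  proof (rule line_locally_dominant[where b = b])
    show "continuous_on layers (\<lambda>p. lev p)" by (intro continuous_intros)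
    show "v1 < v0" "v0 < v2" "b \<le> \<xi>" by fact+
    show "v2 \<le> vertex b" using v2b by (rule less_imp_le)
    show "p = q" if "p \<in> layers" "q \<in> layers" "v1 \<le> lev p" "lev p \<le> v2" "pos q = pos p" "lev q = lev p" for p q
      using that no_vertex by (intro layers_eqI) auto
    show "\<exists>p\<in>layers. lev p = v \<and> vertex a \<le> pos p" if "v1 \<le> v" "v \<le> v2" for v a
    proof -
      have "vertex b \<le> vertex (max a b)" by simp
      then have "v \<le> vertex (max a b)" using that(2) v2b by order
      then have "layer_point (vertex (max a b)) v v \<in> layers" by (intro layer_point_in_layers) simp_all
      then show ?thesis by (rule bexI[rotated]) simp
    qed
  qed
  then show ?thesis by blast
qed

text \<open>
  At positions beyond \<open>b\<close> a depth strictly between its extreme values fixes the level to be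
  \<open>vertex g\<close>.
\<close>

lemma depth_line_dominant:
  assumes "vertex g < w0"
  shows "\<exists>b. \<forall>\<xi>\<ge>b. locally_dominant layered below {p \<in> layers. dep p g = w0 \<and> vertex \<xi> \<le> pos p}"
proof -
  obtain v1 where v1: "vertex g < v1" "v1 < w0" using dense assms by blast
  obtain b where "w0 < vertex b" using longray_less_vertex by blast
  then obtain v2 where v2: "w0 < v2" "v2 < vertex b" using dense by blast
  have lev: "lev p = vertex g"
    if p: "p \<in> layers" "vertex b \<le> pos p" "v1 \<le> dep p g" "dep p g \<le> v2" for p
  proof (rule antisym)
    have "vertex g < dep p g" using p(3) v1(1) by order
    then show "lev p \<le> vertex g" by (rule layersD(6)[OF p(1)])
    have "dep p g < pos p" using p(2,4) v2(2) by order
    then show "vertex g \<le> lev p" by (rule layersD(7)[OF p(1)])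
  qed
  have "locally_dominant layered below {p \<in> layers. dep p g = w0 \<and> vertex \<xi> \<le> pos p}" if "b \<le> \<xi>" for \<xi>
  proof (rule line_locally_dominant[where b = b])
    show "continuous_on layers (\<lambda>p. dep p g)" by (intro continuous_intros)
    show "v1 < w0" "w0 < v2" "b \<le> \<xi>" by fact+
    show "v2 \<le> vertex b" using v2(2) by (rule less_imp_le)
    show "p = q" if "p \<in> layers" "q \<in> layers" "vertex b \<le> pos p" "v1 \<le> dep p g" "dep p g \<le> v2"
      "pos q = pos p" "dep q g = dep p g" for p q
    proof (rule layers_eqI)
      have "lev p = vertex g" "lev q = vertex g" using lev[of p] lev[of q] that by simp_all
      then show "lev p = lev q" "\<And>h. lev p = vertex h \<Longrightarrow> dep p h = dep q h"
        using that by simp_all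
    qed (use that in simp_all)
    show "\<exists>p\<in>layers. dep p g = v \<and> vertex a \<le> pos p" if "v1 \<le> v" "v \<le> v2" for v a
    proof -
      let ?x = "vertex (max a b)"
      have "vertex b \<le> ?x" by simp
      then have "v \<le> ?x" using that(2) v2(2) by order
      moreover have "vertex g \<le> v" using that(1) v1(1) by order
      moreover from calculation have "vertex g \<le> ?x" by order
      ultimately have "layer_point ?x (vertex g) v \<in> layers" by (intro layer_point_in_layers) simp_all
      then show ?thesis by (rule bexI[rotated]) simp
    qed
  qed
  then show ?thesis by blast
qed

section \<open>Every large open set contains a dominant line\<close>

text \<open>
  A pigeonhole principle: the supremum \<open>t0\<close> of the values \<open>t\<close> such that \<open>c\<close> is at least \<open>t\<close> on a
  cofinal part of \<open>C\<close> is approached by points of \<open>C\<close> at arbitrarily large positions, and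
  cluster points of such sequences attain it.
\<close>

lemma cofinal_value:
  fixes \<phi> :: "point \<Rightarrow> longray"
  assumes C: "C \<subseteq> layers" "closed C" "cofinal C" and \<phi>: "continuous_on layers \<phi>"
    and bd: "\<And>p. p \<in> C \<Longrightarrow> \<phi> p \<le> vertex b"
  shows "\<exists>v. cofinal {p \<in> C. \<phi> p = v}"
proof -
  define c where "c = (\<lambda>p. scale b (\<phi> p))"
  define T where "T = {t. cofinal {p \<in> C. t \<le> c p}}"
  have "{p \<in> C. 0 \<le> c p} = C" by (auto simp: c_def scale_bounds)
  then have "0 \<in> T" using C(3) by (simp add: T_def)
  have T_bdd: "bdd_above T"
  proof (rule bdd_aboveI)
    fix t assume "t \<in> T"
    then have "cofinal {p \<in> C. t \<le> c p}" by (simp add: T_def)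
    then obtain p where "t \<le> c p" using cofinalD by blast
    then show "t \<le> 1" using scale_bounds(2)[of b "\<phi> p"] by (simp add: c_def)
  qed
  define t0 where "t0 = Sup T"
  have near: "\<exists>p\<in>layers. vertex a \<le> pos p \<and> (p \<in> C \<and> \<bar>c p - t0\<bar> < 1 / real (Suc n))" for n a
  proof -
    have "t0 - 1 / real (Suc n) < Sup T" by (simp add: t0_def)
    then have "\<exists>t\<in>T. t0 - 1 / real (Suc n) < t" using less_cSup_iff[OF _ T_bdd] \<open>0 \<in> T\<close> by blast
    then obtain t where t: "t \<in> T" "t0 - 1 / real (Suc n) < t" by blast
    have "t0 + 1 / real (Suc n) \<notin> T"
    proof
      assume "t0 + 1 / real (Suc n) \<in> T"
      then have "t0 + 1 / real (Suc n) \<le> t0" unfolding t0_def using T_bdd by (rule cSup_upper)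
      then show False by (simp add: field_simps)
    qed
    then have "\<not> (\<forall>a. \<exists>p\<in>{p \<in> C. t0 + 1 / real (Suc n) \<le> c p}. vertex a \<le> pos p)"
      by (simp only: T_def cofinal_def mem_Collect_eq not_False_eq_True)
    then obtain a' where a': "\<And>p. p \<in> C \<Longrightarrow> t0 + 1 / real (Suc n) \<le> c p \<Longrightarrow> \<not> vertex a' \<le> pos p"
      by blast
    have "cofinal {p \<in> C. t \<le> c p}" using t(1) by (simp add: T_def)
    then obtain p where p: "p \<in> C" "t \<le> c p" "vertex (max a a') \<le> pos p"
      using cofinalD[of "{p \<in> C. t \<le> c p}" "max a a'"] by blast
    have mx: "vertex a \<le> vertex (max a a')" "vertex a' \<le> vertex (max a a')" by simp_all
    have "vertex a' \<le> pos p" using p(3) mx(2) by order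
    then have "c p < t0 + 1 / real (Suc n)" using a'[OF p(1)] by force
    moreover have "vertex a \<le> pos p" using p(3) mx(1) by order
    ultimately show ?thesis using p(1,2) t(2) C(1)
      by (intro bexI[of _ p]) (auto simp: abs_less_iff)
  qed
  have c_cont: "continuous_on layers c" unfolding c_def by (intro continuous_intros \<phi>)
  have hit: "\<exists>q\<in>C. c q = t0 \<and> vertex \<eta> \<le> pos q" for \<eta>
  proof -
    obtain a l p q where s: "\<eta> < a 0" "\<And>n. a n < l"
      and p: "\<And>n. p n \<in> layers" "\<And>n. p n \<in> C \<and> \<bar>c (p n) - t0\<bar> < 1 / real (Suc n)"
        "clusters p q" "q \<in> layers" "pos q = vertex l"
      by (rule leapfrog_single[of "\<lambda>n a p. p \<in> C \<and> \<bar>c p - t0\<bar> < 1 / real (Suc n)" \<eta>, OF near]) (rule that)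
    have "q \<in> C" using p(3) C(2) by (rule clusters_closed) (use p(2) in simp)
    moreover have "c q = t0"
      using p(3,1) c_cont by (rule clusters_tendsto) (rule tendsto_if_dist_inverse, use p(2) in simp)
    moreover have "\<eta> < l" using s(1) s(2)[of 0] by order
    ultimately show ?thesis using p(5) by (intro bexI[of _ q]) auto
  qed
  obtain q0 where q0: "q0 \<in> C" "c q0 = t0" using hit by blast
  have "\<phi> q = \<phi> q0" if "q \<in> C" "c q = t0" for q
    using scale_inj[of b "\<phi> q" "\<phi> q0"] that q0 bd by (simp add: c_def)
  then have "cofinal {p \<in> C. \<phi> p = \<phi> q0}"
    unfolding cofinal_def using hit by (metis (mono_tags, lifting) mem_Collect_eq)
  then show ?thesis by (rule exI)
qed

text \<open>
  The form in which leapfrogging is used to show that two closed sets meet: it suffices that the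
  two sequences can only cluster at one and the same point.
\<close>

lemma meet_in_limit:
  assumes C: "closed C" "\<And>n a. \<exists>p\<in>layers. vertex a \<le> pos p \<and> (p \<in> C \<and> P n a p)"
    and K: "closed K" "\<And>n a. \<exists>p\<in>layers. vertex a \<le> pos p \<and> (p \<in> K \<and> Q n a p)"
    and eq: "\<And>l a p p' q q'. \<lbrakk>\<xi> < l; \<And>n. a n < l; (\<lambda>n. vertex (a n)) \<longlonglongrightarrow> vertex l;
      \<And>n. p n \<in> layers; \<And>n. P n (a n) (p n); \<And>n. pos (p n) < vertex (a (Suc n));
      \<And>n. p' n \<in> layers; \<And>n. Q n (a n) (p' n); \<And>n. pos (p' n) < vertex (a (Suc n));
      clusters p q; clusters p' q'; q \<in> layers; q' \<in> layers; pos q = vertex l; pos q' = vertex l\<rbrakk> \<Longrightarrow> q = q'"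
  shows "C \<inter> K \<noteq> {}"
proof -
  obtain a l p q p' q' where s: "\<xi> < a 0" "\<And>n. a n < l" "(\<lambda>n. vertex (a n)) \<longlonglongrightarrow> vertex l"
    and p: "\<And>n. p n \<in> layers" "\<And>n. p n \<in> C \<and> P n (a n) (p n)" "\<And>n. \<xi> < a (Suc n)"
      "\<And>n. pos (p n) < vertex (a (Suc n))" "clusters p q" "q \<in> layers" "pos q = vertex l"
    and p': "\<And>n. p' n \<in> layers" "\<And>n. p' n \<in> K \<and> Q n (a n) (p' n)"
      "\<And>n. pos (p' n) < vertex (a (Suc n))" "clusters p' q'" "q' \<in> layers" "pos q' = vertex l"
    by (rule leapfrog[of "\<lambda>n a p. p \<in> C \<and> P n a p" "\<lambda>n a p. p \<in> K \<and> Q n a p" \<xi> "\<lambda>_. \<xi>",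
          OF C(2) K(2)]) (rule that)
  have "q \<in> C" using p(5) C(1) by (rule clusters_closed) (use p(2) in simp)
  moreover have "q' \<in> K" using p'(4) K(1) by (rule clusters_closed) (use p'(2) in simp)
  moreover have "\<xi> < l" using s(1) s(2)[of 0] by order
  then have "q = q'"
    by (rule eq[OF _ s(2,3) p(1) _ p(4) p'(1) _ p'(3) p(5) p'(4) p(6) p'(5) p(7) p'(6)])
      (use p(2) p'(2) in simp_all)
  ultimately show ?thesis by blast
qed

lemma line_cofinal_outside:
  assumes none: "\<And>D. locally_dominant layered below D \<Longrightarrow> \<not> D \<subseteq> U"
    and dom: "\<exists>b. \<forall>\<xi>\<ge>b. locally_dominant layered below {p \<in> layers. \<phi> p = v \<and> vertex \<xi> \<le> pos p}"
  shows "cofinal {p \<in> layers - U. \<phi> p = v}"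
  unfolding cofinal_def
proof
  fix a
  obtain b where b: "\<forall>\<xi>\<ge>b. locally_dominant layered below {p \<in> layers. \<phi> p = v \<and> vertex \<xi> \<le> pos p}"
    using dom by blast
  have "locally_dominant layered below {p \<in> layers. \<phi> p = v \<and> vertex (max a b) \<le> pos p}"
    using b by simp
  then obtain p where p: "p \<in> layers" "\<phi> p = v" "vertex (max a b) \<le> pos p" "p \<notin> U"
    using none by blast
  have "vertex a \<le> vertex (max a b)" by simp
  then have "vertex a \<le> pos p" using p(3) by order
  then show "\<exists>p\<in>{p \<in> layers - U. \<phi> p = v}. vertex a \<le> pos p" using p by blast
qed

lemma cofinal_fibreD:
  assumes "cofinal {p \<in> C. \<phi> p = v}" "C \<subseteq> layers"
  shows "\<exists>p\<in>layers. vertex a \<le> pos p \<and> (p \<in> C \<and> \<phi> p = v)"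
  using cofinalD[OF assms(1), of a] assms(2) by blast

lemma closed_fibre_of:
  fixes \<phi> :: "point \<Rightarrow> longray"
  assumes "closed C" "C \<subseteq> layers" "continuous_on layers \<phi>"
  shows "closed {p \<in> C. \<phi> p = v}"
proof -
  have "{p \<in> C. \<phi> p = v} = C \<inter> {p \<in> layers. \<phi> p = v}" using assms(2) by blast
  moreover have "closed {p \<in> layers. \<phi> p = v}" by (intro closed_layers_eq assms continuous_intros)
  ultimately show ?thesis using closed_Int[OF assms(1)] by (simp only:)
qed

lemma clusters_const:
  fixes \<phi> :: "point \<Rightarrow> longray"
  assumes "clusters p q" "\<And>n. p n \<in> layers" "continuous_on layers \<phi>" "\<And>n. \<phi> (p n) = v"
  shows "\<phi> q = v"
  using assms(1,2,3) by (rule clusters_tendsto) (simp_all add: assms(4))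

text \<open>
  Otherwise the complement \<open>K\<close> of \<open>U\<close> meets all dominant lines cofinally, and it has to meet
  \<open>C\<close>. If the level is unbounded on \<open>C\<close>, both sets meet on the diagonal. If not, it may be assumed to
  be constant on \<open>C\<close>, and it suffices to approach by dominant lines the place where \<open>C\<close> is
  unbounded: a line of non-ordinal level is dominant itself; in the octant of \<open>g\<close>, the edge
  \<open>z = x\<close> is approached by lines of increasing ordinal depth, a line of constant depth larger than
  \<open>g\<close> is dominant itself, and the edge \<open>z = g\<close> is approached by lines of non-ordinal levels that
  decrease to \<open>g\<close>.
\<close>

lemma large_contains_dominant:
  assumes U: "openin layered U" and C: "club layered below C" "C \<subseteq> U"
  shows "\<exists>D. locally_dominant layered below D \<and> D \<subseteq> U"
proof (rule ccontr)
  assume "\<not> ?thesis"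
  then have none: "\<not> D \<subseteq> U" if "locally_dominant layered below D" for D using that by blast
  define K where "K = layers - U"
  have K: "closed K" "K \<subseteq> layers"
    using U closedin_diff[OF closedin_topspace U] closedin_closed_eq[OF closed_layers]
    by (auto simp: K_def)
  have CL: "closed C" "C \<subseteq> layers" "cofinal C" using C(1) by (simp_all add: club_layered)
  have disj: "C \<inter> K = {}" using C(2) by (auto simp: K_def)
  have K_lev: "cofinal {p \<in> K. lev p = v}" if "0 < offset v" for v
    unfolding K_def using none level_line_dominant[OF that] by (rule line_cofinal_outside)
  have K_dep: "cofinal {p \<in> K. dep p g = w}" if "vertex g < w" for g w
    unfolding K_def using none depth_line_dominant[OF that] by (rule line_cofinal_outside)
  have lev_cont: "continuous_on layers (\<lambda>p. lev p)" by (intro continuous_intros)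
  have dep_cont: "continuous_on layers (\<lambda>p. dep p g)" for g by (intro continuous_intros)
  show False
  proof (cases "\<forall>a. \<exists>p\<in>C. vertex a \<le> lev p")
    case True
    have "\<exists>p\<in>K. vertex a \<le> lev p" for a
    proof -
      \<comment> \<open>Any level strictly inside the block of \<open>a\<close> will do.\<close>
      have "0 < offset (Abs_longray (a, 1/2))" by simp
      then obtain p where "p \<in> K" "lev p = Abs_longray (a, 1/2)"
        using cofinalD[OF K_lev] by blast
      then show ?thesis by (intro bexI[of _ p]) (simp_all add: vertex_le_iff)
    qed
    then obtain q where "q \<in> C \<inter> K"
      using meet_on_edge[OF CL(1,2) True[rule_format] K] by blast
    then show False using disj by simp
  next
    case False
    then obtain b where "\<And>p. p \<in> C \<Longrightarrow> lev p \<le> vertex b" by (metis linear)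
    then obtain v where v: "cofinal {p \<in> C. lev p = v}"
      using cofinal_value[OF CL(2,1,3) lev_cont] by blast
    define C0 where "C0 = {p \<in> C. lev p = v}"
    have C0: "closed C0" "C0 \<subseteq> layers" "cofinal C0"
      using closed_fibre_of[OF CL(1,2) lev_cont] CL(2) v by (auto simp: C0_def)
    have C0_lev: "lev p = v" if "p \<in> C0" for p using that by (simp add: C0_def)
    show False
    proof (cases "0 < offset v")
      case True
      have "C \<inter> K \<noteq> {}"
      proof (rule meet_in_limit[OF CL(1) cofinal_fibreD[OF v CL(2)] K(1) cofinal_fibreD[OF K_lev[OF True] K(2)]])
        fix l p p' q q'
        assume pq: "\<And>n::nat. p n \<in> layers" "\<And>n. lev (p n) = v" "\<And>n. p' n \<in> layers" "\<And>n. lev (p' n) = v"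
          "clusters p q" "clusters p' q'" "q \<in> layers" "q' \<in> layers" "pos q = vertex l" "pos q' = vertex l"
        have "lev q = v" using pq(5,1) lev_cont pq(2) by (rule clusters_const)
        moreover have "lev q' = v" using pq(6,3) lev_cont pq(4) by (rule clusters_const)
        ultimately show "q = q'"
          using pq(7-10) True by (intro layers_eqI) auto
      qed
      then show False using disj by simp
    next
      case False
      define g where "g = block v"
      have vg: "v = vertex g"
        using False offset_bounds(1)[of v] by (simp add: longray_eq_iff g_def)
      have eq: "q = q'" if "q \<in> layers" "q' \<in> layers" "pos q = pos q'" "lev q = vertex g" "lev q' = vertex g"
        "dep q g = dep q' g" for q q'
        using that by (intro layers_eqI) auto
      show False
      proof (cases "\<forall>a. \<exists>p\<in>C0. vertex a \<le> dep p g")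
        case True
        have C_near: "\<exists>p\<in>layers. vertex a \<le> pos p \<and> (p \<in> C \<and> (lev p = vertex g \<and> vertex a \<le> dep p g))" for a
        proof -
          obtain p where p: "p \<in> C0" "vertex a \<le> dep p g" using True by blast
          then have p': "p \<in> layers" "lev p = vertex g" "p \<in> C"
            using subsetD[OF C0(2) p(1)] C0_lev[OF p(1)] vg by (simp_all add: C0_def)
          have "dep p g \<le> pos p"
            using layersD(3)[OF p'(1), of g] layersD(1)[OF p'(1)] p'(2) by (simp add: max_absorb1)
          then have "vertex a \<le> pos p" using p(2) by order
          then show ?thesis using p p' by blast
        qed
        have K_near: "\<exists>p\<in>layers. vertex a \<le> pos p \<and> (p \<in> K \<and> (lev p = vertex g \<and> vertex a \<le> dep p g))" for a
        proof -
          obtain h where h: "max a g < h" using omega1_gt_ex by blast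
          then have "vertex g < vertex h" by simp
          then have cof: "cofinal {p \<in> K. dep p g = vertex h}" by (rule K_dep)
          obtain h' where h': "h < h'" using omega1_gt_ex by blast
          obtain p where p: "p \<in> K" "dep p g = vertex h" "vertex h' \<le> pos p"
            using cofinalD[OF cof] by blast
          have pl: "p \<in> layers" using p(1) K(2) by blast
          have hh: "vertex h < vertex h'" "vertex a < vertex h" using h h' by simp_all
          have "lev p = vertex g"
          proof (rule antisym)
            show "lev p \<le> vertex g" using layersD(6)[OF pl, of g] p(2) \<open>vertex g < vertex h\<close> by simp
            have "dep p g < pos p" using p(2,3) hh by order
            then show "vertex g \<le> lev p" by (rule layersD(7)[OF pl])
          qed
          moreover have "vertex a \<le> pos p" "vertex a \<le> dep p g" using p(2,3) hh by order+
          ultimately show ?thesis using pl p(1) by blast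
        qed
        have "C \<inter> K \<noteq> {}"
        proof (rule meet_in_limit[OF CL(1) C_near K(1) K_near])
          fix l a p p' q q'
          assume s: "(\<lambda>n. vertex (a n)) \<longlonglongrightarrow> vertex l"
            and p: "\<And>n::nat. p n \<in> layers" "\<And>n. lev (p n) = vertex g \<and> vertex (a n) \<le> dep (p n) g"
            "\<And>n. pos (p n) < vertex (a (Suc n))"
            and p': "\<And>n. p' n \<in> layers" "\<And>n. lev (p' n) = vertex g \<and> vertex (a n) \<le> dep (p' n) g"
            "\<And>n. pos (p' n) < vertex (a (Suc n))"
            and q: "clusters p q" "clusters p' q'" "q \<in> layers" "q' \<in> layers" "pos q = vertex l" "pos q' = vertex l"
          have dep: "dep q g = vertex l"
            if r: "\<And>n::nat. r n \<in> layers" "\<And>n. lev (r n) = vertex g \<and> vertex (a n) \<le> dep (r n) g"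
            "\<And>n. pos (r n) < vertex (a (Suc n))" "clusters r q" for r q
            using r(4,1) dep_cont
          proof (rule clusters_tendsto)
            show "(\<lambda>n. dep (r n) g) \<longlonglongrightarrow> vertex l"
              using s
            proof (rule interleaved_tendsto)
              show "vertex (a n) \<le> dep (r n) g" for n using r(2) by simp
              show "dep (r n) g < vertex (a (Suc n))" for n
              proof -
                have "dep (r n) g \<le> pos (r n)"
                  using layersD(3)[OF r(1), of n g] layersD(1)[OF r(1), of n] r(2)[of n] by (simp add: max_absorb1)
                then show ?thesis using r(3)[of n] by order
              qed
            qed
          qed
          show "q = q'"
          proof (rule eq)
            show "lev q = vertex g" using q(1) p(1) lev_cont by (rule clusters_const) (simp add: p(2))
            show "lev q' = vertex g" using q(2) p'(1) lev_cont by (rule clusters_const) (simp add: p'(2))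
            show "dep q g = dep q' g" using dep[OF p q(1)] dep[OF p' q(2)] by simp
          qed (use q in simp_all)
        qed
        then show False using disj by simp
      next
        case False
        then obtain b' where "\<And>p. p \<in> C0 \<Longrightarrow> dep p g \<le> vertex b'" by (metis linear)
        then obtain w where w: "cofinal {p \<in> C0. dep p g = w}"
          using cofinal_value[OF C0(2,1,3) dep_cont[of g]] by blast
        obtain p0 where "p0 \<in> C0" "dep p0 g = w" using cofinalD[OF w] by blast
        then have gw: "vertex g \<le> w" using layersD(2)[of p0 g] C0(2) by blast
        have C_near: "\<exists>p\<in>layers. vertex a \<le> pos p \<and> (p \<in> C \<and> (lev p = vertex g \<and> dep p g = w))" for a
        proof -
          obtain p where p: "p \<in> layers" "vertex a \<le> pos p" "p \<in> C0" "dep p g = w"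
            using cofinal_fibreD[OF w C0(2)] by blast
          then have "lev p = vertex g" "p \<in> C" using C0_lev[OF p(3)] vg by (simp_all add: C0_def)
          then show ?thesis using p by blast
        qed
        have limC: "lev q = vertex g \<and> dep q g = w"
          if "clusters p q" "\<And>n. p n \<in> layers" "\<And>n. lev (p n) = vertex g \<and> dep (p n) g = w" for p q
          using clusters_const[OF that(1,2) lev_cont] clusters_const[OF that(1,2) dep_cont] that(3) by simp
        have "C \<inter> K \<noteq> {}"
        proof (cases "vertex g < w")
          case True
          obtain \<xi> where \<xi>: "w < vertex \<xi>" using longray_less_vertex by blast
          show ?thesis
          proof (rule meet_in_limit[OF CL(1) C_near K(1) cofinal_fibreD[OF K_dep[OF True] K(2)], of \<xi>])
            fix l p p' q q'
            assume "\<xi> < l" and p: "\<And>n::nat. p n \<in> layers" "\<And>n. lev (p n) = vertex g \<and> dep (p n) g = w"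
              and p': "\<And>n. p' n \<in> layers" "\<And>n. dep (p' n) g = w"
              and q: "clusters p q" "clusters p' q'" "q \<in> layers" "q' \<in> layers" "pos q = vertex l" "pos q' = vertex l"
            have dq': "dep q' g = w" using q(2) p'(1) dep_cont p'(2) by (rule clusters_const)
            have "vertex \<xi> < vertex l" using \<open>\<xi> < l\<close> by simp
            then have "dep q' g < pos q'" using \<xi> dq' q(6) by order
            then have "vertex g \<le> lev q'" by (rule layersD(7)[OF q(4)])
            moreover have "lev q' \<le> vertex g" using layersD(6)[OF q(4), of g] dq' True by simp
            ultimately have "lev q' = vertex g" by order
            then show "q = q'" using limC[OF q(1) p] dq' q by (intro eq) simp_all
          qed
        next
          case False
          then have wg: "w = vertex g" using gw by order
          \<comment> \<open>Non-ordinal levels in the block of \<open>g\<close> that decrease to \<open>g\<close>.\<close>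
          define x where "x n = Abs_longray (g, 1 / real (Suc (Suc n)))" for n
          have bx: "block (x n) = g" "offset (x n) = 1 / real (Suc (Suc n))" for n
            by (simp_all add: x_def)
          have gx: "vertex g < x n" for n by (simp add: less_longray_iff bx)
          have x_lim: "x \<longlonglongrightarrow> vertex g"
          proof (rule order_tendstoI)
            fix y assume "y < vertex g"
            then show "\<forall>\<^sub>F n in sequentially. y < x n" using gx less_trans by (intro always_eventually) blast
          next
            fix y assume y: "vertex g < y"
            show "\<forall>\<^sub>F n in sequentially. x n < y"
            proof (cases "g < block y")
              case True
              then show ?thesis by (simp add: less_longray_iff bx)
            next
              case False
              then have "block y = g" "0 < offset y" using y by (auto simp: less_longray_iff)
              moreover have "(\<lambda>n. 1 / real (Suc (Suc n))) \<longlonglongrightarrow> 0"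
                using LIMSEQ_Suc[OF LIMSEQ_inverse_real_of_nat] by (simp add: inverse_eq_divide)
              ultimately show ?thesis
                using order_tendstoD(2)[of "\<lambda>n. 1 / real (Suc (Suc n))" 0 sequentially "offset y"]
                by (simp add: less_longray_iff bx)
            qed
          qed
          have "0 < offset (x n)" for n by (simp add: bx)
          then have K_near: "\<exists>p\<in>layers. vertex a \<le> pos p \<and> (p \<in> K \<and> lev p = x n)" for n a
            using cofinal_fibreD[OF K_lev K(2)] by blast
          show ?thesis
          proof (rule meet_in_limit[OF CL(1) C_near K(1) K_near])
            fix l p p' q q'
            assume p: "\<And>n::nat. p n \<in> layers" "\<And>n. lev (p n) = vertex g \<and> dep (p n) g = w"
              and p': "\<And>n. p' n \<in> layers" "\<And>n. lev (p' n) = x n"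
              and q: "clusters p q" "clusters p' q'" "q \<in> layers" "q' \<in> layers" "pos q = vertex l" "pos q' = vertex l"
            have "dep (p' n) g = vertex g" for n using layersD(4)[OF p'(1)] gx p'(2) by simp
            with q(2) p'(1) dep_cont have "dep q' g = vertex g" by (rule clusters_const)
            moreover have "lev q' = vertex g"
              using q(2) p'(1) lev_cont by (rule clusters_tendsto) (simp add: p'(2) x_lim)
            ultimately show "q = q'" using limC[OF q(1) p] wg q by (intro eq) simp_all
          qed
        qed
        then show False using disj by simp
      qed
    qed
  qed
qed

lemma spanned_layered: "spanned_by_dominant layered below"
  unfolding spanned_by_dominant_def large_def using large_contains_dominant by blast

lemma lev_unbounded: "\<not> bounded_on lev layers"
proof
  assume "bounded_on lev layers"
  then obtain b where b: "\<forall>p\<in>layers. lev p < vertex b" by (auto simp: longray_bounded_iff)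
  have "layer_point (vertex b) (vertex b) (vertex b) \<in> layers" by (rule layer_point_in_layers) auto
  then show False using b by force
qed

section \<open>Homeomorphic copies of Type I spaces\<close>

lemma homeomorphic_map_Lindelof:
  assumes "homeomorphic_map X Y h" "Lindelof_space X"
  shows "Lindelof_space Y"
  using assms(2) homeomorphic_imp_continuous_map[OF assms(1)] homeomorphic_imp_surjective_map[OF assms(1)]
  by (rule Lindelof_space_continuous_map_image)

text \<open>
  A homeomorphism with a given inverse that carries one witnessing family to the other. Recording
  the inverse makes the relation symmetric, so implications need to be proved in one direction
  only.
\<close>

definition type_I_iso :: "'a topology \<Rightarrow> (omega1 \<Rightarrow> 'a set) \<Rightarrow> 'b topology \<Rightarrow> (omega1 \<Rightarrow> 'b set) \<Rightarrow>
    ('a \<Rightarrow> 'b) \<Rightarrow> ('b \<Rightarrow> 'a) \<Rightarrow> bool"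
  where "type_I_iso X F Y G h k \<longleftrightarrow> homeomorphic_maps X Y h k \<and>
     (\<forall>a. F a \<subseteq> topspace X \<and> G a = h ` F a)"

context
  fixes X :: "'a topology" and F and Y :: "'b topology" and G h k
  assumes tr: "type_I_iso X F Y G h k"
begin

lemma type_I_iso_maps: "homeomorphic_maps X Y h k"
  using tr by (simp add: type_I_iso_def)

lemma type_I_iso_map: "homeomorphic_map X Y h"
  using type_I_iso_maps homeomorphic_maps_map by blast

lemma type_I_iso_kh: "x \<in> topspace X \<Longrightarrow> k (h x) = x"
  and type_I_iso_hk: "y \<in> topspace Y \<Longrightarrow> h (k y) = y"
  and type_I_iso_h: "x \<in> topspace X \<Longrightarrow> h x \<in> topspace Y"
  and type_I_iso_k: "y \<in> topspace Y \<Longrightarrow> k y \<in> topspace X"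
  using type_I_iso_maps by (auto simp: homeomorphic_maps_def continuous_map_def)

lemma type_I_iso_F: "F a \<subseteq> topspace X" "G a = h ` F a"
  using tr by (auto simp: type_I_iso_def)

lemma type_I_iso_image_k: "A \<subseteq> topspace X \<Longrightarrow> k ` h ` A = A"
  and type_I_iso_image_h: "B \<subseteq> topspace Y \<Longrightarrow> h ` k ` B = B"
  using type_I_iso_kh type_I_iso_hk by (force simp: image_image)+

lemma type_I_iso_sym: "type_I_iso Y G X F k h"
proof -
  have "G a \<subseteq> topspace Y" "F a = k ` G a" for a
    using type_I_iso_F[of a] type_I_iso_h type_I_iso_image_k[OF type_I_iso_F(1)] by auto
  moreover have "homeomorphic_maps Y X k h"
    using type_I_iso_maps homeomorphic_maps_sym[of X Y h k] by (rule iffD1[rotated])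
  ultimately show ?thesis by (simp add: type_I_iso_def)
qed

lemma type_I_iso_bounded:
  assumes "A \<subseteq> topspace X" "type_I_bounded G (h ` A)"
  shows "type_I_bounded F A"
proof -
  obtain a where "h ` A \<subseteq> h ` F a" using assms(2) type_I_iso_F(2) by (auto simp: type_I_bounded_def)
  then have "k ` h ` A \<subseteq> k ` h ` F a" by (rule image_mono)
  then have "A \<subseteq> F a" using type_I_iso_image_k assms(1) type_I_iso_F(1) by simp
  then show ?thesis by (auto simp: type_I_bounded_def)
qed

lemma type_I_iso_club:
  assumes "club X F C"
  shows "club Y G (h ` C)"
proof -
  have C: "closedin X C" "\<not> type_I_bounded F C" using assms by (auto simp: club_def)
  then have "C \<subseteq> topspace X" by (simp add: closedin_subset)
  then show ?thesis
    using C type_I_iso_bounded homeomorphic_map_closedness_eq[OF type_I_iso_map]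
    unfolding club_def by blast
qed

lemma type_I_iso_open: "openin X U \<Longrightarrow> openin Y (h ` U)"
  using homeomorphic_map_openness_eq[OF type_I_iso_map] by blast

lemma type_I_iso_surface:
  assumes "surface X"
  shows "surface Y"
  unfolding surface_def
proof (intro conjI ballI)
  have XY: "X homeomorphic_space Y" using type_I_iso_maps homeomorphic_space_def by blast
  show "Hausdorff_space Y" "connected_space Y"
    using assms homeomorphic_Hausdorff_space[OF XY] homeomorphic_connected_space[OF XY]
    by (simp_all add: surface_def)
  fix y assume y: "y \<in> topspace Y"
  then obtain U V where U: "openin X U" "k y \<in> U" "openin half_plane V"
    "subtopology X U homeomorphic_space subtopology half_plane V"
    using assms type_I_iso_k[OF y] unfolding surface_def by blast
  have UX: "U \<subseteq> topspace X" using U(1) by (rule openin_subset)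
  have "homeomorphic_map (subtopology X U) (subtopology Y (h ` U)) h"
  proof (rule homeomorphic_map_subtopologies[OF type_I_iso_map])
    have "h ` topspace X = topspace Y" using type_I_iso_map by (rule homeomorphic_imp_surjective_map)
    then show "h ` (topspace X \<inter> U) = topspace Y \<inter> h ` U" using UX by blast
  qed
  then have "subtopology Y (h ` U) homeomorphic_space subtopology X U"
    using homeomorphic_map_imp_homeomorphic_space homeomorphic_space_sym by blast
  then have "subtopology Y (h ` U) homeomorphic_space subtopology half_plane V"
    using U(4) by (rule homeomorphic_space_trans)
  moreover have "y \<in> h ` U" using U(2) type_I_iso_hk[OF y] by force
  ultimately show "\<exists>U V. openin Y U \<and> y \<in> U \<and> openin half_plane V \<and>
      subtopology Y U homeomorphic_space subtopology half_plane V"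
    using type_I_iso_open[OF U(1)] U(3) by blast
qed

lemma type_I_iso_type_I:
  assumes "type_I X F"
  shows "type_I Y G"
proof -
  have XY: "X homeomorphic_space Y" using type_I_iso_maps homeomorphic_space_def by blast
  have cl: "Y closure_of G a = h ` (X closure_of F a)" for a
    using homeomorphic_map_closure_of[OF type_I_iso_map type_I_iso_F(1)] type_I_iso_F(2) by simp
  have surj: "h ` topspace X = topspace Y" using type_I_iso_map by (rule homeomorphic_imp_surjective_map)
  show ?thesis
    unfolding type_I_def
  proof (intro conjI allI impI)
    show "Hausdorff_space Y" using assms homeomorphic_Hausdorff_space[OF XY] by (simp add: type_I_def)
    have "homeomorphic_map Y X k"
      using type_I_iso_maps homeomorphic_maps_map by blast
    then show "\<not> Lindelof_space Y" using assms homeomorphic_map_Lindelof unfolding type_I_def by blast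
    have "topspace X = (\<Union>a. F a)" using assms by (simp add: type_I_def)
    then show "topspace Y = (\<Union>a. G a)"
      unfolding type_I_iso_F(2) surj[symmetric] by (simp only: image_UN)
    show "openin Y (G a)" for a
      using assms type_I_iso_open[of "F a"] type_I_iso_F(2) by (simp add: type_I_def)
    show "Lindelof_space (subtopology Y (Y closure_of G a))" for a
    proof -
      have "homeomorphic_map (subtopology X (X closure_of F a)) (subtopology Y (Y closure_of G a)) h"
      proof (rule homeomorphic_map_subtopologies[OF type_I_iso_map])
        have "X closure_of F a \<subseteq> topspace X" by (rule closure_of_subset_topspace)
        then show "h ` (topspace X \<inter> X closure_of F a) = topspace Y \<inter> Y closure_of G a"
          unfolding cl using surj by blast
      qed
      moreover have "Lindelof_space (subtopology X (X closure_of F a))"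
        using assms by (simp add: type_I_def)
      ultimately show ?thesis by (rule homeomorphic_map_Lindelof)
    qed
    show "Y closure_of G a \<subseteq> G b" if "a < b" for a b
      unfolding cl type_I_iso_F(2)[of b] using assms that by (intro image_mono) (simp add: type_I_def)
  qed
qed

lemma type_I_iso_omega_bounded:
  assumes "omega_bounded_space X"
  shows "omega_bounded_space Y"
  unfolding omega_bounded_space_def
proof (intro allI impI)
  fix B assume B: "B \<subseteq> topspace Y \<and> countable B"
  then have kB: "k ` B \<subseteq> topspace X" "countable (k ` B)" using type_I_iso_k by auto
  then have "compactin X (X closure_of (k ` B))" using assms by (simp add: omega_bounded_space_def)
  then have "compactin Y (h ` (X closure_of (k ` B)))"
    using homeomorphic_imp_continuous_map[OF type_I_iso_map] by (rule image_compactin)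
  moreover have "Y closure_of (h ` k ` B) = h ` (X closure_of (k ` B))"
    using homeomorphic_map_closure_of[OF type_I_iso_map kB(1)] .
  ultimately show "compactin Y (Y closure_of B)" using type_I_iso_image_h B by simp
qed

end

lemma type_I_iso_dominant:
  assumes tr: "type_I_iso X F Y G h k" and D: "locally_dominant X F D"
  shows "locally_dominant Y G (h ` D)"
proof -
  note sym = type_I_iso_sym[OF tr]
  have "\<exists>U. openin X U \<and> D \<subseteq> U \<and>
        (\<forall>f C D'. continuous_map X euclidean f \<and> club X F C \<and> C \<subseteq> U \<and>
           club X F D' \<and> D' \<subseteq> D \<and> bounded_on f D' \<longrightarrow> bounded_on f C)"
    using D unfolding locally_dominant_def by (rule conjunct2)
  then obtain U where U: "openin X U" "D \<subseteq> U" and dom: "\<forall>f C D'. continuous_map X euclidean f \<and>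
      club X F C \<and> C \<subseteq> U \<and> club X F D' \<and> D' \<subseteq> D \<and> bounded_on f D' \<longrightarrow> bounded_on f C"
    by (elim exE conjE)
  have UX: "U \<subseteq> topspace X" using U(1) by (rule openin_subset)
  have "bounded_on f C"
    if f: "continuous_map Y euclidean f" and C: "club Y G C" "C \<subseteq> h ` U"
      and D': "club Y G D'" "D' \<subseteq> h ` D" "bounded_on f D'" for f C D'
  proof -
    have CY: "C \<subseteq> topspace Y" "D' \<subseteq> topspace Y"
      using C(1) D'(1) by (auto simp: club_def dest: closedin_subset)
    have img: "(f \<circ> h) ` k ` A = f ` A" if "A \<subseteq> topspace Y" for A
      using type_I_iso_image_h[OF tr that] by (metis image_comp)
    have "continuous_map X euclidean (f \<circ> h)"
      using homeomorphic_imp_continuous_map[OF type_I_iso_map[OF tr]] f by (rule continuous_map_compose)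
    moreover have "club X F (k ` C)" "club X F (k ` D')"
      using type_I_iso_club[OF sym] C(1) D'(1) by blast+
    moreover have "k ` C \<subseteq> U" using image_mono[OF C(2), of k] type_I_iso_image_k[OF tr UX] by simp
    moreover have "k ` D' \<subseteq> D"
      using image_mono[OF D'(2), of k] type_I_iso_image_k[OF tr, of D] U(2) UX by simp
    moreover have "bounded_on (f \<circ> h) (k ` D')" using D'(3) img[OF CY(2)] by (simp add: bounded_on_def)
    ultimately have "bounded_on (f \<circ> h) (k ` C)" using dom by blast
    then show ?thesis using img[OF CY(1)] by (simp add: bounded_on_def)
  qed
  moreover have "club Y G (h ` D)" using type_I_iso_club[OF tr] D by (simp add: locally_dominant_def)
  ultimately show ?thesis
    unfolding locally_dominant_def using type_I_iso_open[OF tr U(1)] U(2)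
    by (intro conjI exI[of _ "h ` U"]) blast+
qed

lemma type_I_iso_spanned:
  assumes tr: "type_I_iso X F Y G h k" and X: "spanned_by_dominant X F"
  shows "spanned_by_dominant Y G"
  unfolding spanned_by_dominant_def
proof (intro allI impI)
  note sym = type_I_iso_sym[OF tr]
  fix U assume "large Y G U"
  then obtain C where U: "openin Y U" "club Y G C" "C \<subseteq> U" by (auto simp: large_def)
  then have "large X F (k ` U)"
    unfolding large_def using type_I_iso_open[OF sym] type_I_iso_club[OF sym] by blast
  then obtain D where D: "locally_dominant X F D" "D \<subseteq> k ` U"
    using X unfolding spanned_by_dominant_def by blast
  have "h ` D \<subseteq> h ` k ` U" using D(2) by (rule image_mono)
  then have "h ` D \<subseteq> U" using type_I_iso_image_h[OF tr openin_subset[OF U(1)]] by simp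
  then show "\<exists>D. locally_dominant Y G D \<and> D \<subseteq> U" using type_I_iso_dominant[OF tr D(1)] by blast
qed

section \<open>A copy of the surface on the real numbers\<close>

text \<open>
  The successor cardinal of \<open>\<omega>\<close> embeds in every uncountable set, in particular in the reals.
\<close>

lemma ex_inj_omega1_real: "\<exists>e :: omega1 \<Rightarrow> real. inj e"
proof -
  include cardinal_syntax
  have "\<not> |UNIV :: real set| \<le>o natLeq"
    using uncountable_UNIV_real by (simp add: countable_card_le_natLeq)
  then have "natLeq <o |UNIV :: real set|"
    using not_ordLeq_iff_ordLess[OF natLeq_Well_order card_of_Well_order] by blast
  then have "cardSuc natLeq \<le>o |UNIV :: real set|"
    by (rule cardSuc_least[OF natLeq_Card_order card_of_Card_order])
  moreover have "|Field (cardSuc natLeq)| =o cardSuc natLeq"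
    by (rule card_of_Field_ordIso[OF cardSuc_Card_order[OF natLeq_Card_order]])
  ultimately have "|Field (cardSuc natLeq)| \<le>o |UNIV :: real set|"
    by (rule ordIso_ordLeq_trans[rotated])
  then obtain j :: "nat set \<Rightarrow> real" where j: "inj_on j (Field (cardSuc natLeq))"
    unfolding card_of_ordLeq[symmetric] by blast
  have "inj (\<lambda>a. j (Rep_omega1 a))"
  proof (rule injI)
    fix a b assume "j (Rep_omega1 a) = j (Rep_omega1 b)"
    then have "Rep_omega1 a = Rep_omega1 b" by (rule inj_onD[OF j _ Rep_omega1 Rep_omega1])
    then show "a = b" by (simp only: Rep_omega1_inject)
  qed
  then show ?thesis by blast
qed

lemma ex_inj_real_pair: "\<exists>e :: real \<times> real \<Rightarrow> real. inj e"
proof -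
  include cardinal_syntax
  have "|(UNIV :: real set) \<times> (UNIV :: real set)| =o |UNIV :: real set|"
    by (rule card_of_Times_same_infinite) (rule infinite_UNIV_char_0)
  then have "|UNIV :: (real \<times> real) set| \<le>o |UNIV :: real set|"
    by (simp add: ordIso_imp_ordLeq)
  then show ?thesis unfolding card_of_ordLeq[symmetric] by blast
qed

text \<open>
  By \<open>layers_eqI\<close> a point is determined by its position, its level and the depth at the block of
  its level.
\<close>

lemma ex_inj_layers_real: "\<exists>e :: point \<Rightarrow> real. inj_on e layers"
proof -
  obtain e1 :: "omega1 \<Rightarrow> real" where e1: "inj e1" using ex_inj_omega1_real by blast
  obtain e2 :: "real \<times> real \<Rightarrow> real" where e2: "inj e2" using ex_inj_real_pair by blast
  define e3 where "e3 x = e2 (e1 (block x), offset x)" for x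
  have e3: "inj e3"
  proof (rule injI)
    fix x y assume "e3 x = e3 y"
    then have "e1 (block x) = e1 (block y) \<and> offset x = offset y"
      unfolding e3_def using e2 by (simp add: inj_eq)
    then show "x = y" using e1 by (simp add: inj_eq longray_eq_iff)
  qed
  define e where "e p = e2 (e3 (pos p), e2 (e3 (lev p), e3 (dep p (block (lev p)))))" for p
  have "inj_on e layers"
  proof (rule inj_onI)
    fix p q assume pq: "p \<in> layers" "q \<in> layers" "e p = e q"
    then have "pos p = pos q \<and> lev p = lev q \<and> dep p (block (lev p)) = dep q (block (lev q))"
      unfolding e_def inj_eq[OF e2] inj_eq[OF e3] prod.inject by blast
    then have "pos p = pos q" "lev p = lev q" "dep p (block (lev p)) = dep q (block (lev q))"
      by blast+
    note eqs = this
    show "p = q"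
    proof (rule layers_eqI[OF pq(1,2) eqs(1,2)])
      fix g assume "lev p = vertex g"
      then show "dep p g = dep q g" using eqs(2,3) by simp
    qed
  qed
  then show ?thesis by blast
qed

text \<open>
  The topology of \<open>X\<close> is pulled back along the inverse of the injection.
\<close>

lemma ex_type_I_iso:
  fixes e :: "'a \<Rightarrow> 'b"
  assumes "inj_on e (topspace X)" "\<And>a. F a \<subseteq> topspace X"
  shows "\<exists>(Y :: 'b topology) G k. type_I_iso X F Y G e k"
proof -
  define k where "k = inv_into (topspace X) e"
  define Y where "Y = pullback_topology (e ` topspace X) k X"
  have ke: "k (e x) = x" if "x \<in> topspace X" for x
    using assms(1) that by (simp add: k_def)
  have top: "topspace Y = e ` topspace X"
    using ke by (auto simp: Y_def topspace_pullback_topology)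
  have "continuous_map X Y e"
    unfolding Y_def
  proof (rule continuous_map_pullback')
    show "continuous_map X X (k \<circ> e)"
      by (rule continuous_map_eq[OF continuous_map_id]) (simp add: ke)
  qed auto
  moreover have "continuous_map Y X k"
    unfolding Y_def using continuous_map_pullback[OF continuous_map_id, of _ k X] by simp
  ultimately have "homeomorphic_maps X Y e k"
    using ke top by (auto simp: homeomorphic_maps_def)
  then have "type_I_iso X F Y (\<lambda>a. e ` F a) e k" using assms(2) by (simp add: type_I_iso_def)
  then show ?thesis by blast
qed

(* The points of S may be taken to be reals: every Type I surface has at most continuum
   many points, so up to homeomorphism no surface is excluded by this choice. *)
theorem theorem9p4:
  shows "\<exists>(S :: real topology) (F :: omega1 \<Rightarrow> real set).
     surface S \<and> type_I S F \<and> omega_bounded_space S \<and> spanned_by_dominant S F \<and>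
     (\<exists>f :: real \<Rightarrow> longray. continuous_map S euclidean f \<and>
        \<not> bounded_on f (topspace S) \<and>
        (\<forall>D. locally_dominant S F D \<longrightarrow> bounded_on f D))"
proof -
  obtain e :: "point \<Rightarrow> real" where "inj_on e layers" using ex_inj_layers_real by blast
  then obtain S :: "real topology" and F k where tr: "type_I_iso layered below S F e k"
    using ex_type_I_iso[of e layered below] below_subset by auto
  note sym = type_I_iso_sym[OF tr]
  define f where "f = lev \<circ> k"
  have img: "f ` e ` A = lev ` A" if "A \<subseteq> layers" for A
    using type_I_iso_image_k[OF tr, of A] that unfolding f_def by (metis image_comp topspace_euclidean_subtopology)
  have "continuous_map S euclidean f"
    unfolding f_def
  proof (rule continuous_map_compose)
    show "continuous_map S layered k"
      using type_I_iso_map[OF sym] by (rule homeomorphic_imp_continuous_map)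
    show "continuous_map layered euclidean lev"
      unfolding continuous_map_layered by (intro continuous_intros)
  qed
  moreover have "\<not> bounded_on f (topspace S)"
  proof -
    have "topspace S = e ` layers"
      using homeomorphic_imp_surjective_map[OF type_I_iso_map[OF tr]] by simp
    then show ?thesis using lev_unbounded img[of layers] by (simp add: bounded_on_def)
  qed
  moreover have "bounded_on f D" if D: "locally_dominant S F D" for D
  proof -
    have DS: "D \<subseteq> topspace S"
      using D by (auto simp: locally_dominant_def club_def dest: closedin_subset)
    have "bounded_on lev (k ` D)"
      using type_I_iso_dominant[OF sym D] by (rule lev_bounded_if_dominant)
    then show ?thesis by (simp add: bounded_on_def f_def image_comp)
  qed
  moreover have "surface S" using tr surface_layered by (rule type_I_iso_surface)
  moreover have "type_I S F" using tr type_I_layered by (rule type_I_iso_type_I)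
  moreover have "omega_bounded_space S" using tr omega_bounded_layered by (rule type_I_iso_omega_bounded)
  moreover have "spanned_by_dominant S F" using tr spanned_layered by (rule type_I_iso_spanned)
  ultimately show ?thesis by blast
qed

end
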